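(* Let $E$ be a finite set, let $\mathcal{M}$ be a matroid on $E$ with rank function $\rho$ such that $\rho(E)=r-1$, and let $\mathcal{O}$ be an oriented matroid of rank $r$ on the same ground set $E$. Suppose that every double circuit $D$ of $\mathcal{M}$ contains a positive cocircuit of $\mathcal{O}$ (i.e. there is a positive cocircuit $Y$ of $\mathcal{O}$ with $\underline{Y}\subseteq D$). Then there exists a positive cocircuit $C$ of $\mathcal{O}$ whose complement spans $\mathcal{M}$, i.e. $\rho(E\setminus \underline{C})=\rho(E)$.
   Context: A double circuit of a matroid $\mathcal{M}$ with rank function $\rho$ is a subset $D\subseteq E$ with $\rho(D)=|D|-2$ and $\rho(D\setminus\{e\})=|D|-2$ for every $e\in D$. Oriented matroids are given by their signed circuits, where a signed subset of $E$ is a pair $X=(X^+,X^-)$ of disjoint subsets of $E$ with support $\underline{X}=X^+\cup X^-$; the rank of an oriented matroid is the rank of its underlying matroid (whose circuits are the supports of the signed circuits). Two signed sets $X,Y$ are orthogonal if $\underline{X}\cap\underline{Y}=\emptyset$ or the restrictions of $X$ and $Y$ to $\underline{X}\cap\underline{Y}$ are neither equal nor opposite. The cocircuits of $\mathcal{O}$ are the signed circuits of the dual oriented matroid, i.e. the elements of the unique maximal family of signed sets orthogonal to all signed circuits of $\mathcal{O}$. A positive cocircuit is a cocircuit of the form $(Y^+,\emptyset)$. *)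

theory Defs
  imports Main
begin

section \<open>Matroids\<close>

definition matroid :: "'a set \<Rightarrow> ('a set \<Rightarrow> bool) \<Rightarrow> bool" where
  "matroid E indep \<longleftrightarrow>
     finite E \<and>
     (\<forall>A. indep A \<longrightarrow> A \<subseteq> E) \<and>
     indep {} \<and>
     (\<forall>A B. indep A \<longrightarrow> B \<subseteq> A \<longrightarrow> indep B) \<and>
     (\<forall>A B. indep A \<longrightarrow> indep B \<longrightarrow> card A < card B \<longrightarrow>
        (\<exists>b \<in> B - A. indep (insert b A)))"

definition matroid_rank :: "('a set \<Rightarrow> bool) \<Rightarrow> 'a set \<Rightarrow> nat" where
  "matroid_rank indep A = Max {card B | B. B \<subseteq> A \<and> indep B}"

text \<open>The equations \<open>\<rho>(D) = |D| - 2\<close> and \<open>\<rho>(D - {e}) = |D| - 2\<close> are equations of integers;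
  they are written additively because subtraction on \<^typ>\<open>nat\<close> truncates.\<close>

definition double_circuit :: "'a set \<Rightarrow> ('a set \<Rightarrow> bool) \<Rightarrow> 'a set \<Rightarrow> bool" where
  "double_circuit E indep D \<longleftrightarrow>
     D \<subseteq> E \<and> matroid_rank indep D + 2 = card D \<and>
     (\<forall>e \<in> D. matroid_rank indep (D - {e}) + 2 = card D)"

section \<open>Signed sets\<close>

text \<open>A signed set \<open>X\<close> is the pair of its positive part \<open>fst X\<close> and its negative part \<open>snd X\<close>.\<close>

type_synonym 'a signed = "'a set \<times> 'a set"

definition signed_subset :: "'a set \<Rightarrow> 'a signed \<Rightarrow> bool" where
  "signed_subset E X \<longleftrightarrow> fst X \<subseteq> E \<and> snd X \<subseteq> E \<and> fst X \<inter> snd X = {}"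

definition supp :: "'a signed \<Rightarrow> 'a set" where
  "supp X = fst X \<union> snd X"

definition opposite :: "'a signed \<Rightarrow> 'a signed" where
  "opposite X = (snd X, fst X)"

definition restriction :: "'a signed \<Rightarrow> 'a set \<Rightarrow> 'a signed" where
  "restriction X A = (fst X \<inter> A, snd X \<inter> A)"

definition orthogonal :: "'a signed \<Rightarrow> 'a signed \<Rightarrow> bool" where
  "orthogonal X Y \<longleftrightarrow>
     supp X \<inter> supp Y = {} \<or>
     (restriction X (supp X \<inter> supp Y) \<noteq> restriction Y (supp X \<inter> supp Y) \<and>
      restriction X (supp X \<inter> supp Y) \<noteq> opposite (restriction Y (supp X \<inter> supp Y)))"

section \<open>Oriented matroids\<close>

text \<open>The signed circuit axioms: nonemptiness, symmetry, incomparability, weak elimination.\<close>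

definition oriented_matroid :: "'a set \<Rightarrow> 'a signed set \<Rightarrow> bool" where
  "oriented_matroid E \<C> \<longleftrightarrow>
     finite E \<and>
     (\<forall>X \<in> \<C>. signed_subset E X) \<and>
     ({}, {}) \<notin> \<C> \<and>
     (\<forall>X \<in> \<C>. opposite X \<in> \<C>) \<and>
     (\<forall>X \<in> \<C>. \<forall>Y \<in> \<C>. supp X \<subseteq> supp Y \<longrightarrow> X = Y \<or> X = opposite Y) \<and>
     (\<forall>X \<in> \<C>. \<forall>Y \<in> \<C>. \<forall>e. X \<noteq> opposite Y \<longrightarrow> e \<in> fst X \<inter> snd Y \<longrightarrow>
        (\<exists>Z \<in> \<C>. fst Z \<subseteq> (fst X \<union> fst Y) - {e} \<and> snd Z \<subseteq> (snd X \<union> snd Y) - {e}))"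

text \<open>The independent sets of the underlying matroid, i.e. of the matroid whose circuits are the
  supports of the signed circuits.\<close>

definition underlying_indep :: "'a set \<Rightarrow> 'a signed set \<Rightarrow> 'a set \<Rightarrow> bool" where
  "underlying_indep E \<C> A \<longleftrightarrow> A \<subseteq> E \<and> (\<forall>X \<in> \<C>. \<not> supp X \<subseteq> A)"

definition oriented_matroid_rank :: "'a set \<Rightarrow> 'a signed set \<Rightarrow> nat" where
  "oriented_matroid_rank E \<C> = matroid_rank (underlying_indep E \<C>) E"

text \<open>The maximal family of signed subsets of \<open>E\<close> orthogonal to all signed circuits (the covectors)
  always contains the empty signed set and is closed under composition. The signed circuits of the
  dual oriented matroid are its nonempty members of inclusion-minimal support.\<close>

definition covectors :: "'a set \<Rightarrow> 'a signed set \<Rightarrow> 'a signed set" where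
  "covectors E \<C> = {Y. signed_subset E Y \<and> (\<forall>X \<in> \<C>. orthogonal X Y)}"

definition cocircuits :: "'a set \<Rightarrow> 'a signed set \<Rightarrow> 'a signed set" where
  "cocircuits E \<C> =
     {Y \<in> covectors E \<C>. supp Y \<noteq> {} \<and>
        (\<forall>Z \<in> covectors E \<C>. supp Z \<noteq> {} \<longrightarrow> \<not> supp Z \<subset> supp Y)}"

definition positive_cocircuit :: "'a set \<Rightarrow> 'a signed set \<Rightarrow> 'a signed \<Rightarrow> bool" where
  "positive_cocircuit E \<C> Y \<longleftrightarrow> Y \<in> cocircuits E \<C> \<and> snd Y = {}"

end

(* Let K be the complex of all faces of the nonnegative cone of the covectors of the oriented
  matroid, a face being given by the set of elements vanishing on it.  A face that spans the matroid
  yields the positive cocircuit, so suppose that no face does.  By deletion and contraction,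
  removing from K the vertices of a set A leaves a complex without reduced homology (mod 2)
  in dimensions up to r - 2 - max |A| 1; a set A of nullity at least 2 contains a double circuit, and
  then K - A is a full simplex.  Hence K - A has no homology up to dimension rho(E) - 2 - rho(A)
  for every A.  Filling cycles along chains of nonspanning flats F1 < F2 < ... inside K - F1 gives a
  chain map from the order complex of these flats to K, and sending a face to the flats
  spanned by its nonempty subfaces gives one back.  The order complex is a cone over the flat cl {},
  so the composite has Lefschetz number 0; but it fixes only the empty chain, since no nonempty
  subface of a face avoiding F1 spans F1. *)

theory Submission
  imports Defs "HOL-Library.Z2"
begin

section \<open>Chains modulo 2\<close>

text \<open>The dimension counts meet with nothing to spare. The oriented matroid has one unit of
  rank more than the matroid, and this unit pays for sets of nullity one; nullity two is where that
  estimate breaks down, and there the hypothesis on double circuits takes over. On the side of the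
  flats, a chain of k + 1 nonspanning flats with bottom F has distinct ranks between \<rho>(F) and
  \<rho>(E) - 1, so it asks for a filling exactly within the degrees in which K - F is known to be
  acyclic. The obstacle is that no sphere or ball is at hand without a topological representation of
  the oriented matroid. Homology is therefore computed from covectors, and only in the degrees that
  occur; chain maps take the place of continuous maps. Coefficients modulo 2 remove all orientations
  of simplices and still suffice, because the contradiction is a trace that equals both 0 and 1. The
  1 comes from the empty simplex, which is kept in both complexes. Only weak elimination of circuits
  is given, so strong elimination, a painting lemma and elimination for covectors have to be derived
  before the faces can be handled.\<close>

declare add_bit_eq_xor [simp del] mult_bit_eq_and [simp del]
  bit_not_zero_iff [simp del] bit_not_one_iff [simp del]

lemma bit_double [simp]: "x + x = (0::bit)"
  by (cases x) auto

text \<open>Each unordered pair is counted twice and cancels modulo 2. This takes the place of sign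
  bookkeeping, for the square of the boundary as well as for the cycles to be filled in
  \<open>carrier_chain_map\<close>.\<close>

lemma sum_offdiag_sym:
  fixes f :: "'b \<Rightarrow> 'b \<Rightarrow> bit"
  assumes "finite S" and sym: "\<And>x y. f x y = f y x"
  shows "(\<Sum>x\<in>S. \<Sum>y\<in>S - {x}. f x y) = 0"
  using assms(1)
proof (induction S)
  case (insert a S)
  have "(\<Sum>x\<in>S. \<Sum>y\<in>insert a S - {x}. f x y) = (\<Sum>x\<in>S. f a x + (\<Sum>y\<in>S - {x}. f x y))"
  proof (rule sum.cong)
    fix x assume "x \<in> S"
    then have "insert a S - {x} = insert a (S - {x})" "a \<notin> S - {x}" "finite (S - {x})"
      using insert by auto
    then show "(\<Sum>y\<in>insert a S - {x}. f x y) = f a x + (\<Sum>y\<in>S - {x}. f x y)"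
      by (simp add: sym)
  qed simp
  moreover have "insert a S - {a} = S" using insert by auto
  ultimately show ?case
    using insert by (simp add: sum.distrib)
qed simp

text \<open>The usual boundary read off at a face: \<open>\<tau>\<close> collects the coefficients
  of the simplices with one more vertex. \<open>V\<close> only has to contain all vertices in use,
  so chains of different subcomplexes share one operator.\<close>

definition bd :: "'v set \<Rightarrow> ('v set \<Rightarrow> bit) \<Rightarrow> 'v set \<Rightarrow> bit" where
  "bd V z = (\<lambda>\<tau>. \<Sum>x\<in>V - \<tau>. z (insert x \<tau>))"

text \<open>Simplices of \<open>z\<close> that already contain \<open>g\<close> are dropped, because
  \<open>\<sigma> - {g}\<close> never contains \<open>g\<close>. With this convention
  \<open>cone_homotopy\<close> holds for every \<open>z\<close>: the cone of the boundary restores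
  what was dropped.\<close>

definition cone :: "'v \<Rightarrow> ('v set \<Rightarrow> bit) \<Rightarrow> 'v set \<Rightarrow> bit" where
  "cone g z = (\<lambda>\<sigma>. if g \<in> \<sigma> then z (\<sigma> - {g}) else 0)"

definition simplicial_chain :: "'v set set \<Rightarrow> nat \<Rightarrow> ('v set \<Rightarrow> bit) \<Rightarrow> bool" where
  "simplicial_chain K k z \<longleftrightarrow> (\<forall>\<sigma>. z \<sigma> \<noteq> 0 \<longrightarrow> \<sigma> \<in> K \<and> card \<sigma> = k)"

text \<open>Faces are indexed by cardinality and the empty face counts, so this is the vanishing of reduced
  homology in dimension \<open>k - 1\<close>.\<close>

definition acyclic_at :: "'v set \<Rightarrow> 'v set set \<Rightarrow> nat \<Rightarrow> bool" where
  "acyclic_at V K k \<longleftrightarrow>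
     (\<forall>z. simplicial_chain K k z \<longrightarrow> bd V z = (\<lambda>_. 0) \<longrightarrow> (\<exists>w. simplicial_chain K (Suc k) w \<and> bd V w = z))"

lemma simplicial_chain_mono: "simplicial_chain K k z \<Longrightarrow> K \<subseteq> L \<Longrightarrow> simplicial_chain L k z"
  by (auto simp: simplicial_chain_def)

lemma simplicial_chain_add: "simplicial_chain K k u \<Longrightarrow> simplicial_chain K k w \<Longrightarrow> simplicial_chain K k (\<lambda>\<sigma>. u \<sigma> + w \<sigma>)"
  unfolding simplicial_chain_def by (metis add_0)

lemma bd_add: "bd V (\<lambda>\<sigma>. u \<sigma> + w \<sigma>) = (\<lambda>\<tau>. bd V u \<tau> + bd V w \<tau>)"
  by (simp add: bd_def sum.distrib)

lemma bd_sum: "bd V (\<lambda>\<sigma>. \<Sum>i\<in>I. u i \<sigma>) = (\<lambda>\<tau>. \<Sum>i\<in>I. bd V (u i) \<tau>)"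
  unfolding bd_def by (rule ext, rule sum.swap)

lemma bd_bd:
  assumes "finite V" shows "bd V (bd V z) = (\<lambda>_. 0)"
proof
  fix \<tau>
  have "bd V (bd V z) \<tau> = (\<Sum>x\<in>V - \<tau>. \<Sum>y\<in>(V - \<tau>) - {x}. z (insert y (insert x \<tau>)))"
    unfolding bd_def by (intro sum.cong) auto
  also have "\<dots> = 0"
    by (rule sum_offdiag_sym) (use assms in \<open>auto simp: insert_commute\<close>)
  finally show "bd V (bd V z) \<tau> = 0" .
qed

lemma cone_homotopy:
  assumes "finite V" "g \<in> V"
  shows "bd V (cone g z) \<tau> + cone g (bd V z) \<tau> = z \<tau>"
proof (cases "g \<in> \<tau>")
  case False
  have "bd V (cone g z) \<tau> = (\<Sum>x\<in>V - \<tau>. if x = g then z \<tau> else 0)"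
    unfolding bd_def cone_def using False by (intro sum.cong) auto
  then show ?thesis using assms False by (simp add: cone_def)
next
  case True
  have "bd V z (\<tau> - {g}) = (\<Sum>x\<in>insert g (V - \<tau>). z (insert x (\<tau> - {g})))"
    unfolding bd_def using True assms by (intro sum.cong) auto
  also have "\<dots> = z \<tau> + (\<Sum>x\<in>V - \<tau>. z (insert x (\<tau> - {g})))"
    using True assms by (simp add: insert_absorb)
  also have "(\<Sum>x\<in>V - \<tau>. z (insert x (\<tau> - {g}))) = bd V (cone g z) \<tau>"
    unfolding bd_def cone_def using True
    by (intro sum.cong) (auto intro: arg_cong[where f=z])
  finally show ?thesis using True by (simp add: cone_def add.left_commute)
qed

lemma bd_cone:
  assumes "finite V" "g \<in> V" "bd V z = (\<lambda>_. 0)"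
  shows "bd V (cone g z) = z"
  using cone_homotopy[OF assms(1,2), of z] assms(3) by (auto simp: cone_def fun_eq_iff)

section \<open>Acyclicity of cones and of complexes glued along a link\<close>

lemma simplicial_chain_bd:
  assumes "finite V" "simplicial_chain K (Suc k) z" "\<And>\<sigma> \<tau>. \<sigma> \<in> K \<Longrightarrow> \<tau> \<subseteq> \<sigma> \<Longrightarrow> \<tau> \<in> K"
    "\<And>\<sigma>. \<sigma> \<in> K \<Longrightarrow> finite \<sigma>"
  shows "simplicial_chain K k (bd V z)"
  unfolding simplicial_chain_def
proof (intro allI impI)
  fix \<tau> assume "bd V z \<tau> \<noteq> 0"
  then obtain x where x: "x \<in> V - \<tau>" "z (insert x \<tau>) \<noteq> 0"
    unfolding bd_def by (meson sum.neutral)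
  then have "insert x \<tau> \<in> K" "card (insert x \<tau>) = Suc k"
    using assms(2) by (auto simp: simplicial_chain_def)
  then show "\<tau> \<in> K \<and> card \<tau> = k"
    using x assms(3)[of "insert x \<tau>" \<tau>] assms(4)[of "insert x \<tau>"] by auto
qed

text \<open>Filling a cycle of degree \<open>k\<close> only joins faces of cardinality
  \<open>k\<close> to the apex. Restricting the condition to these faces also covers the boundary of
  a simplex below its top dimension, which is not a cone.\<close>

lemma acyclic_at_cone:
  assumes "finite V" "g \<in> V" "\<And>\<sigma>. \<sigma> \<in> K \<Longrightarrow> finite \<sigma>"
    and "\<And>\<sigma>. \<sigma> \<in> K \<Longrightarrow> card \<sigma> = k \<Longrightarrow> g \<notin> \<sigma> \<Longrightarrow> insert g \<sigma> \<in> K"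
  shows "acyclic_at V K k"
  unfolding acyclic_at_def
proof (intro allI impI)
  fix z assume z: "simplicial_chain K k z" "bd V z = (\<lambda>_. 0)"
  have "simplicial_chain K (Suc k) (cone g z)"
    unfolding simplicial_chain_def
  proof (intro allI impI)
    fix \<sigma> assume "cone g z \<sigma> \<noteq> 0"
    then have s: "g \<in> \<sigma>" "z (\<sigma> - {g}) \<noteq> 0"
      by (auto simp: cone_def split: if_splits)
    then have "\<sigma> - {g} \<in> K" "card (\<sigma> - {g}) = k"
      using z(1) by (auto simp: simplicial_chain_def)
    moreover have "insert g (\<sigma> - {g}) = \<sigma>" using s by auto
    ultimately show "\<sigma> \<in> K \<and> card \<sigma> = Suc k"
      using assms(3)[of "\<sigma> - {g}"] assms(4)[of "\<sigma> - {g}"]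
      by (metis Diff_iff card_insert_disjoint insertI1)
  qed
  then show "\<exists>w. simplicial_chain K (Suc k) w \<and> bd V w = z"
    using bd_cone[OF assms(1,2) z(2)] by blast
qed

text \<open>Mayer-Vietoris carried out on chains. A cycle is pushed off \<open>g\<close> by a
  filling in the link \<open>K0 \<inter> K1\<close> and then bounds in
  \<open>K0 \<union> K1\<close>; the part of that filling outside \<open>K0\<close> has its boundary
  in the link, so the cone over this boundary with apex \<open>g\<close> can replace it.\<close>

lemma acyclic_at_glue:
  assumes fin: "finite V" and g: "g \<in> V"
    and K0: "\<And>\<sigma>. \<sigma> \<in> K0 \<Longrightarrow> \<sigma> \<subseteq> V - {g}" "\<And>\<sigma> \<tau>. \<sigma> \<in> K0 \<Longrightarrow> \<tau> \<subseteq> \<sigma> \<Longrightarrow> \<tau> \<in> K0"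
    and K1: "\<And>\<sigma>. \<sigma> \<in> K1 \<Longrightarrow> \<sigma> \<subseteq> V - {g}" "\<And>\<sigma> \<tau>. \<sigma> \<in> K1 \<Longrightarrow> \<tau> \<subseteq> \<sigma> \<Longrightarrow> \<tau> \<in> K1"
    and link: "\<And>j. k = Suc j \<Longrightarrow> acyclic_at V (K0 \<inter> K1) j"
    and un: "acyclic_at V (K0 \<union> K1) k"
  shows "acyclic_at V (K0 \<union> insert g ` (K0 \<inter> K1)) k" (is "acyclic_at V ?K k")
  unfolding acyclic_at_def
proof (intro allI impI)
  let ?L = "K0 \<inter> K1"
  have finL: "finite \<sigma>" if "\<sigma> \<in> K0 \<or> \<sigma> \<in> K1" for \<sigma>
    using that K0(1) K1(1) fin by (meson finite_Diff finite_subset)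
  have ngL: "g \<notin> \<sigma>" if "\<sigma> \<in> K0 \<or> \<sigma> \<in> K1" for \<sigma>
    using that K0(1) K1(1) by blast
  have coneL: "simplicial_chain ?K (Suc i) (cone g w)" if "simplicial_chain ?L i w" for i w
    unfolding simplicial_chain_def
  proof (intro allI impI)
    fix \<sigma> assume "cone g w \<sigma> \<noteq> 0"
    then have s: "g \<in> \<sigma>" "w (\<sigma> - {g}) \<noteq> 0"
      by (auto simp: cone_def split: if_splits)
    then have t: "\<sigma> - {g} \<in> ?L" "card (\<sigma> - {g}) = i"
      using that by (auto simp: simplicial_chain_def)
    then have "insert g (\<sigma> - {g}) \<in> ?K" by blast
    moreover have eq: "insert g (\<sigma> - {g}) = \<sigma>" using s by auto
    moreover have "card (insert g (\<sigma> - {g})) = Suc i"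
      using t finL[of "\<sigma> - {g}"] by (subst card_insert_disjoint) auto
    ultimately show "\<sigma> \<in> ?K \<and> card \<sigma> = Suc i" by metis
  qed
  fix z assume z: "simplicial_chain ?K k z" "bd V z = (\<lambda>_. 0)"
  \<comment> \<open>\<open>b\<close> is the link component of \<open>z\<close> at \<open>g\<close>.
    It is itself a cycle, and a chain \<open>w\<close> of the link that it bounds makes
    \<open>z'\<close> below free of simplices containing \<open>g\<close>.\<close>
  define b where "b = (\<lambda>\<tau>. if g \<in> \<tau> then 0 else z (insert g \<tau>))"
  have bdb: "bd V b = (\<lambda>_. 0)"
  proof
    fix \<tau>
    show "bd V b \<tau> = 0"
    proof (cases "g \<in> \<tau>")
      case True then show ?thesis by (simp add: bd_def b_def)
    next
      case False
      have "bd V b \<tau> = (\<Sum>x\<in>V - insert g \<tau>. b (insert x \<tau>))"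
        unfolding bd_def by (rule sum.mono_neutral_right) (use fin in \<open>auto simp: b_def\<close>)
      also have "\<dots> = bd V z (insert g \<tau>)"
        unfolding bd_def b_def using False by (intro sum.cong) (auto simp: insert_commute)
      finally show ?thesis using z by simp
    qed
  qed
  have bL: "\<tau> \<in> ?L \<and> Suc (card \<tau>) = k" if "b \<tau> \<noteq> 0" for \<tau>
  proof -
    have 1: "g \<notin> \<tau>" "z (insert g \<tau>) \<noteq> 0" using that by (auto simp: b_def split: if_splits)
    then have 2: "insert g \<tau> \<in> ?K" "card (insert g \<tau>) = k" using z(1) by (auto simp: simplicial_chain_def)
    then obtain \<tau>' where "\<tau>' \<in> ?L" "insert g \<tau> = insert g \<tau>'" using ngL by blast
    then have "\<tau> \<in> ?L" using 1 ngL[of \<tau>'] by (metis Diff_insert_absorb IntD1)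
    then show ?thesis using 1 2 finL[of \<tau>] by auto
  qed
  obtain w where w: "simplicial_chain ?L k w" "bd V w = b"
  proof (cases k)
    case 0
    then have "b = (\<lambda>_. 0)" using bL by fastforce
    then show ?thesis by (intro that[of "\<lambda>_. 0"]) (auto simp: simplicial_chain_def bd_def)
  next
    case (Suc j)
    then have "simplicial_chain ?L j b" using bL by (auto simp: simplicial_chain_def)
    then show ?thesis using link[OF Suc] bdb that Suc unfolding acyclic_at_def by blast
  qed
  define z' where "z' = (\<lambda>\<sigma>. z \<sigma> + bd V (cone g w) \<sigma>)"
  have "bd V z' = (\<lambda>_. 0)"
    unfolding z'_def bd_add using z(2) bd_bd[OF fin] by simp
  moreover have z'eq: "z' \<sigma> = (if g \<in> \<sigma> then 0 else z \<sigma> + w \<sigma>)" for \<sigma>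
  proof -
    have h: "bd V (cone g w) \<sigma> = w \<sigma> + cone g b \<sigma>"
      using cone_homotopy[OF fin g, of w \<sigma>] w(2) by (metis add.assoc add.right_neutral bit_double)
    have w0: "w \<sigma> = 0" if "g \<in> \<sigma>"
      using that w(1) ngL[of \<sigma>] by (auto simp: simplicial_chain_def)
    have "insert g (\<sigma> - {g}) = \<sigma>" if "g \<in> \<sigma>" using that by auto
    then show ?thesis unfolding z'_def h using w0 by (simp add: cone_def b_def)
  qed
  have z'K0: "simplicial_chain K0 k z'"
    unfolding simplicial_chain_def
  proof (intro allI impI)
    fix \<sigma> assume "z' \<sigma> \<noteq> 0"
    then have "g \<notin> \<sigma>" "z \<sigma> \<noteq> 0 \<or> w \<sigma> \<noteq> 0" using z'eq by (auto split: if_splits)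
    then show "\<sigma> \<in> K0 \<and> card \<sigma> = k" using z(1) w(1) unfolding simplicial_chain_def by auto
  qed
  ultimately obtain u where u: "simplicial_chain (K0 \<union> K1) (Suc k) u" "bd V u = z'"
    using un simplicial_chain_mono[OF z'K0, of "K0 \<union> K1"] unfolding acyclic_at_def by blast
  define u1 where "u1 = (\<lambda>\<sigma>. if \<sigma> \<in> K0 then u \<sigma> else 0)"
  define u2 where "u2 = (\<lambda>\<sigma>. if \<sigma> \<in> K0 then 0 else u \<sigma>)"
  have u12: "simplicial_chain K0 (Suc k) u1" "simplicial_chain K1 (Suc k) u2"
    using u(1) by (auto simp: simplicial_chain_def u1_def u2_def)
  have "u = (\<lambda>\<sigma>. u1 \<sigma> + u2 \<sigma>)" by (auto simp: u1_def u2_def)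
  then have split: "z' \<sigma> = bd V u1 \<sigma> + bd V u2 \<sigma>" for \<sigma>
    using u(2) bd_add by metis
  have c1: "simplicial_chain K0 k (bd V u1)"
    by (rule simplicial_chain_bd[OF fin u12(1)]) (use K0 finL in blast)+
  have c2: "simplicial_chain K1 k (bd V u2)"
    by (rule simplicial_chain_bd[OF fin u12(2)]) (use K1 finL in blast)+
  have "bd V u2 \<sigma> = z' \<sigma> + bd V u1 \<sigma>" for \<sigma>
    using split[of \<sigma>] by (cases "bd V u1 \<sigma>"; cases "bd V u2 \<sigma>") auto
  then have "simplicial_chain K0 k (bd V u2)"
    using simplicial_chain_add[OF z'K0 c1] by (simp add: simplicial_chain_def)
  then have cL: "simplicial_chain ?L k (bd V u2)"
    using c2 by (auto simp: simplicial_chain_def)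
  \<comment> \<open>The cone over \<open>bd V u2\<close> stands in for \<open>u2\<close>, and the
    cone over \<open>w\<close> undoes the correction that led from \<open>z\<close> to
    \<open>z'\<close>.\<close>
  let ?y = "\<lambda>\<sigma>. bd V u2 \<sigma> + w \<sigma>"
  let ?t = "\<lambda>\<sigma>. u1 \<sigma> + cone g ?y \<sigma>"
  have "simplicial_chain ?K (Suc k) ?t"
    using simplicial_chain_add[OF simplicial_chain_mono[OF u12(1)] coneL[OF simplicial_chain_add[OF cL w(1)]]] by blast
  moreover have "bd V ?t = z"
  proof
    fix \<sigma>
    have cc: "cone g ?y = (\<lambda>\<sigma>. cone g (bd V u2) \<sigma> + cone g w \<sigma>)"
      by (auto simp: cone_def)
    have "bd V ?t \<sigma> = bd V u1 \<sigma> + (bd V u2 \<sigma> + bd V (cone g w) \<sigma>)"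
      unfolding bd_add cc using bd_cone[OF fin g bd_bd[OF fin], of u2] by simp
    also have "\<dots> = z' \<sigma> + bd V (cone g w) \<sigma>" using split by (simp add: add.assoc)
    also have "\<dots> = z \<sigma>" unfolding z'_def by (simp add: add.assoc)
    finally show "bd V ?t \<sigma> = z \<sigma>" .
  qed
  ultimately show "\<exists>t. simplicial_chain ?K (Suc k) t \<and> bd V t = z" by blast
qed

section \<open>Acyclic carriers and a fixed point theorem\<close>

text \<open>The method of acyclic carriers: the images of the facets of \<open>\<sigma>\<close> add
  up to a cycle in \<open>\<Gamma> \<sigma>\<close>, which is filled there. Each carrier has to be
  acyclic only in the single degree where this filling happens. Fixing \<open>\<Phi> {}\<close> as
  the empty simplex is the augmentation condition, which later yields a nonzero diagonal
  entry.\<close>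

lemma carrier_chain_map:
  fixes \<Gamma> :: "'w set \<Rightarrow> 'v set set"
  assumes finV: "finite V" and finW: "finite W" and XW: "X \<subseteq> Pow W"
    and down: "\<And>\<sigma> \<tau>. \<sigma> \<in> X \<Longrightarrow> \<tau> \<subseteq> \<sigma> \<Longrightarrow> \<tau> \<in> X"
    and mono: "\<And>\<sigma> \<tau>. \<sigma> \<in> X \<Longrightarrow> \<tau> \<subseteq> \<sigma> \<Longrightarrow> \<Gamma> \<tau> \<subseteq> \<Gamma> \<sigma>"
    and empty: "{} \<in> \<Gamma> {}"
    and acyc: "\<And>\<sigma> k. \<sigma> \<in> X \<Longrightarrow> card \<sigma> = Suc k \<Longrightarrow> acyclic_at V (\<Gamma> \<sigma>) k"
  shows "\<exists>\<Phi>. \<Phi> {} = (\<lambda>\<tau>. if \<tau> = {} then 1 else 0) \<and>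
    (\<forall>\<sigma>\<in>X. simplicial_chain (\<Gamma> \<sigma>) (card \<sigma>) (\<Phi> \<sigma>)) \<and>
    (\<forall>\<sigma>\<in>X. bd V (\<Phi> \<sigma>) = (\<lambda>\<tau>. \<Sum>x\<in>\<sigma>. \<Phi> (\<sigma> - {x}) \<tau>))"
proof -
  define good where "good = (\<lambda>(\<Phi> :: 'w set \<Rightarrow> 'v set \<Rightarrow> bit) \<sigma>. simplicial_chain (\<Gamma> \<sigma>) (card \<sigma>) (\<Phi> \<sigma>) \<and>
    bd V (\<Phi> \<sigma>) = (\<lambda>\<tau>. \<Sum>x\<in>\<sigma>. \<Phi> (\<sigma> - {x}) \<tau>))"
  have finX: "finite \<sigma>" if "\<sigma> \<in> X" for \<sigma>
    using that XW finW finite_subset by blast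
  have "\<exists>\<Phi>. \<Phi> {} = (\<lambda>\<tau>. if \<tau> = {} then 1 else 0) \<and> (\<forall>\<sigma>\<in>X. card \<sigma> \<le> n \<longrightarrow> good \<Phi> \<sigma>)" for n
  proof (induction n)
    case 0
    let ?d = "\<lambda>\<tau> :: 'v set. if \<tau> = {} then 1 else (0 :: bit)"
    have "good (\<lambda>_. ?d) {}"
      using empty unfolding good_def by (auto simp: simplicial_chain_def bd_def)
    then show ?case using finX by (intro exI[of _ "\<lambda>_. ?d"]) auto
  next
    case (Suc n)
    then obtain \<Phi> where \<Phi>: "\<Phi> {} = (\<lambda>\<tau>. if \<tau> = {} then 1 else 0)"
      and gd: "\<And>\<sigma>. \<sigma> \<in> X \<Longrightarrow> card \<sigma> \<le> n \<Longrightarrow> good \<Phi> \<sigma>" by blast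
    have ex: "\<exists>w. simplicial_chain (\<Gamma> \<sigma>) (Suc n) w \<and> bd V w = (\<lambda>\<tau>. \<Sum>x\<in>\<sigma>. \<Phi> (\<sigma> - {x}) \<tau>)"
      if s: "\<sigma> \<in> X" "card \<sigma> = Suc n" for \<sigma>
    proof -
      have face: "\<sigma> - {x} \<in> X" "card (\<sigma> - {x}) = n" if "x \<in> \<sigma>" for x
        using that s finX down[OF s(1)] by (auto simp: card_Diff_singleton)
      have "simplicial_chain (\<Gamma> \<sigma>) n (\<lambda>\<tau>. \<Sum>x\<in>\<sigma>. \<Phi> (\<sigma> - {x}) \<tau>)"
        unfolding simplicial_chain_def
      proof (intro allI impI)
        fix \<tau> assume "(\<Sum>x\<in>\<sigma>. \<Phi> (\<sigma> - {x}) \<tau>) \<noteq> 0"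
        then obtain x where x: "x \<in> \<sigma>" "\<Phi> (\<sigma> - {x}) \<tau> \<noteq> 0" by (meson sum.neutral)
        then have "\<tau> \<in> \<Gamma> (\<sigma> - {x})" "card \<tau> = n"
          using gd[of "\<sigma> - {x}"] face[OF x(1)] unfolding good_def simplicial_chain_def by auto
        then show "\<tau> \<in> \<Gamma> \<sigma> \<and> card \<tau> = n" using mono[OF s(1), of "\<sigma> - {x}"] by blast
      qed
      moreover have "bd V (\<lambda>\<tau>. \<Sum>x\<in>\<sigma>. \<Phi> (\<sigma> - {x}) \<tau>) = (\<lambda>_. 0)"
      proof
        fix \<tau>
        have "bd V (\<lambda>\<tau>. \<Sum>x\<in>\<sigma>. \<Phi> (\<sigma> - {x}) \<tau>) \<tau> = (\<Sum>x\<in>\<sigma>. \<Sum>y\<in>\<sigma> - {x}. \<Phi> (\<sigma> - {x} - {y}) \<tau>)"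
          unfolding bd_sum using gd face by (intro sum.cong) (auto simp: good_def)
        also have "\<dots> = 0"
        proof (rule sum_offdiag_sym[OF finX[OF s(1)]])
          fix x y
          have "\<sigma> - {x} - {y} = \<sigma> - {y} - {x}" by blast
          then show "\<Phi> (\<sigma> - {x} - {y}) \<tau> = \<Phi> (\<sigma> - {y} - {x}) \<tau>" by (rule arg_cong)
        qed
        finally show "bd V (\<lambda>\<tau>. \<Sum>x\<in>\<sigma>. \<Phi> (\<sigma> - {x}) \<tau>) \<tau> = 0" .
      qed
      ultimately show ?thesis using acyc[OF s] unfolding acyclic_at_def by blast
    qed
    \<comment> \<open>Only simplices of cardinality \<open>Suc n\<close> get a new value. The
      choices are independent of each other, since each boundary condition refers to facets
      alone.\<close>
    define \<Psi> where "\<Psi> = (\<lambda>\<sigma>. if \<sigma> \<in> X \<and> card \<sigma> = Suc n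
      then SOME w. simplicial_chain (\<Gamma> \<sigma>) (Suc n) w \<and> bd V w = (\<lambda>\<tau>. \<Sum>x\<in>\<sigma>. \<Phi> (\<sigma> - {x}) \<tau>)
      else \<Phi> \<sigma>)"
    have low: "\<Psi> (\<sigma> - {x}) = \<Phi> (\<sigma> - {x})" if "\<sigma> \<in> X" "card \<sigma> \<le> Suc n" "x \<in> \<sigma>" for \<sigma> x
    proof -
      have "card (\<sigma> - {x}) < card \<sigma>" using that finX by (meson card_Diff1_less)
      then show ?thesis using that by (simp add: \<Psi>_def)
    qed
    have "good \<Psi> \<sigma>" if s: "\<sigma> \<in> X" "card \<sigma> \<le> Suc n" for \<sigma>
    proof (cases "card \<sigma> = Suc n")
      case True
      then have "simplicial_chain (\<Gamma> \<sigma>) (Suc n) (\<Psi> \<sigma>) \<and>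
          bd V (\<Psi> \<sigma>) = (\<lambda>\<tau>. \<Sum>x\<in>\<sigma>. \<Phi> (\<sigma> - {x}) \<tau>)"
        unfolding \<Psi>_def using s(1) someI_ex[OF ex[OF s(1) True]] by simp
      then show ?thesis unfolding good_def using True low[OF s] by simp
    next
      case False
      then have "\<Psi> \<sigma> = \<Phi> \<sigma>" "good \<Phi> \<sigma>" using gd s by (simp_all add: \<Psi>_def)
      then show ?thesis unfolding good_def using low[OF s] by simp
    qed
    moreover have "\<Psi> {} = (\<lambda>\<tau>. if \<tau> = {} then 1 else 0)" using \<Phi> by (simp add: \<Psi>_def)
    ultimately show ?case by blast
  qed
  then obtain \<Phi> where \<Phi>: "\<Phi> {} = (\<lambda>\<tau>. if \<tau> = {} then 1 else 0)"
    "\<And>\<sigma>. \<sigma> \<in> X \<Longrightarrow> card \<sigma> \<le> card W \<Longrightarrow> good \<Phi> \<sigma>" by blast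
  have "card \<sigma> \<le> card W" if "\<sigma> \<in> X" for \<sigma> using that XW finW by (auto intro: card_mono)
  then show ?thesis using \<Phi> unfolding good_def by blast
qed

lemma chain_map_compose:
  fixes \<Phi> :: "'w set \<Rightarrow> 'v set \<Rightarrow> bit" and \<Psi> :: "'v set \<Rightarrow> 'u set \<Rightarrow> bit"
  assumes finV: "finite V"
    and supp: "\<And>\<sigma>. \<Phi> c \<sigma> \<noteq> 0 \<Longrightarrow> \<sigma> \<in> K"
    and bd1: "bd V (\<Phi> c) = (\<lambda>\<tau>. \<Sum>x\<in>c. \<Phi> (c - {x}) \<tau>)"
    and bd2: "\<And>\<sigma>. \<sigma> \<in> K \<Longrightarrow> bd W (\<Psi> \<sigma>) = (\<lambda>\<tau>. \<Sum>x\<in>\<sigma>. \<Psi> (\<sigma> - {x}) \<tau>)"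
  shows "bd W (\<lambda>d. \<Sum>\<sigma>\<in>Pow V. \<Phi> c \<sigma> * \<Psi> \<sigma> d) = (\<lambda>d. \<Sum>x\<in>c. \<Sum>\<sigma>\<in>Pow V. \<Phi> (c - {x}) \<sigma> * \<Psi> \<sigma> d)"
proof
  fix d
  have "bd W (\<lambda>d. \<Sum>\<sigma>\<in>Pow V. \<Phi> c \<sigma> * \<Psi> \<sigma> d) d = (\<Sum>\<sigma>\<in>Pow V. \<Phi> c \<sigma> * bd W (\<Psi> \<sigma>) d)"
    unfolding bd_sum by (simp add: bd_def sum_distrib_left)
  also have "\<dots> = (\<Sum>\<sigma>\<in>Pow V. \<Sum>x\<in>\<sigma>. \<Phi> c \<sigma> * \<Psi> (\<sigma> - {x}) d)"
  proof (rule sum.cong)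
    fix \<sigma>
    show "\<Phi> c \<sigma> * bd W (\<Psi> \<sigma>) d = (\<Sum>x\<in>\<sigma>. \<Phi> c \<sigma> * \<Psi> (\<sigma> - {x}) d)"
    proof (cases "\<Phi> c \<sigma> = 0")
      case False
      then show ?thesis using bd2[OF supp[OF False]] by (simp add: sum_distrib_left)
    qed simp
  qed simp
  also have "\<dots> = (\<Sum>(\<sigma>, x)\<in>Sigma (Pow V) (\<lambda>\<sigma>. \<sigma>). \<Phi> c \<sigma> * \<Psi> (\<sigma> - {x}) d)"
    by (rule sum.Sigma) (use finV finite_subset in auto)
  \<comment> \<open>A simplex with a marked vertex is the same as a facet together with the vertex
    to be added; under this exchange the boundary moves from \<open>\<Psi>\<close> to
    \<open>\<Phi> c\<close>.\<close>
  also have "\<dots> = (\<Sum>(\<tau>, x)\<in>Sigma (Pow V) (\<lambda>\<tau>. V - \<tau>). \<Phi> c (insert x \<tau>) * \<Psi> \<tau> d)"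
    by (rule sum.reindex_bij_witness[where j = "\<lambda>(\<sigma>, x). (\<sigma> - {x}, x)" and i = "\<lambda>(\<tau>, x). (insert x \<tau>, x)"])
      (auto simp: insert_absorb)
  also have "\<dots> = (\<Sum>\<tau>\<in>Pow V. \<Sum>x\<in>V - \<tau>. \<Phi> c (insert x \<tau>) * \<Psi> \<tau> d)"
    by (rule sum.Sigma[symmetric]) (use finV in auto)
  also have "\<dots> = (\<Sum>\<tau>\<in>Pow V. bd V (\<Phi> c) \<tau> * \<Psi> \<tau> d)"
    by (simp add: bd_def sum_distrib_right)
  also have "\<dots> = (\<Sum>x\<in>c. \<Sum>\<sigma>\<in>Pow V. \<Phi> (c - {x}) \<sigma> * \<Psi> \<sigma> d)"
    unfolding bd1 sum_distrib_right by (rule sum.swap)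
  finally show "bd W (\<lambda>d. \<Sum>\<sigma>\<in>Pow V. \<Phi> c \<sigma> * \<Psi> \<sigma> d) d =
    (\<Sum>x\<in>c. \<Sum>\<sigma>\<in>Pow V. \<Phi> (c - {x}) \<sigma> * \<Psi> \<sigma> d)" .
qed

text \<open>Hopf's trace formula for a contractible complex: with \<open>id = \<partial> s + s \<partial>\<close>, the trace of \<open>f\<close> is
  \<open>tr (f \<partial> s) + tr (\<partial> f s) = 0\<close> modulo 2.\<close>

lemma cone_chain_map_trace_zero:
  fixes f :: "'w set \<Rightarrow> 'w set \<Rightarrow> bit"
  assumes finW: "finite W" and XW: "X \<subseteq> Pow W"
    and down: "\<And>c d. c \<in> X \<Longrightarrow> d \<subseteq> c \<Longrightarrow> d \<in> X"
    and p: "p \<in> W" and apex: "\<And>c. c \<in> X \<Longrightarrow> insert p c \<in> X"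
    and supp: "\<And>c d. c \<in> X \<Longrightarrow> f c d \<noteq> 0 \<Longrightarrow> d \<in> X"
    and bd: "\<And>c. c \<in> X \<Longrightarrow> bd W (f c) = (\<lambda>d. \<Sum>x\<in>c. f (c - {x}) d)"
  shows "(\<Sum>c\<in>X. f c c) = 0"
proof -
  define X0 where "X0 = {c \<in> X. p \<notin> c}"
  have finX: "finite X" using XW finW by (meson finite_Pow_iff finite_subset)
  then have fin0: "finite X0" by (simp add: X0_def)
  have finc: "finite c" if "c \<in> X" for c using that XW finW finite_subset by blast
  have X: "X = X0 \<union> insert p ` X0"
  proof
    show "X \<subseteq> X0 \<union> insert p ` X0"
    proof
      fix c assume c: "c \<in> X"
      show "c \<in> X0 \<union> insert p ` X0"
      proof (cases "p \<in> c")
        case True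
        then have "c = insert p (c - {p})" by auto
        moreover have "c - {p} \<in> X0" using down[OF c] by (simp add: X0_def)
        ultimately show ?thesis by blast
      qed (use c in \<open>simp add: X0_def\<close>)
    qed
  qed (use apex in \<open>auto simp: X0_def\<close>)
  have inj: "inj_on (insert p) X0"
    by (simp add: inj_on_def X0_def insert_ident)
  \<comment> \<open>Both sides come from the coefficient of \<open>c\<close> in the boundary of
    \<open>f (insert p c)\<close>, computed once by definition and once by the chain map property,
    where \<open>f c c\<close> is the term for the removed vertex \<open>p\<close>.\<close>
  have step: "f c c + f (insert p c) (insert p c) =
      (\<Sum>x\<in>c. f (insert p (c - {x})) c) + (\<Sum>x\<in>{x \<in> W - insert p c. insert x c \<in> X}. f (insert p c) (insert x c))"
    if c: "c \<in> X0" for c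
  proof -
    have cX: "c \<in> X" "p \<notin> c" "insert p c \<in> X" using c apex by (auto simp: X0_def)
    have "(\<Sum>x\<in>W - insert p c. f (insert p c) (insert x c)) =
        (\<Sum>x\<in>{x \<in> W - insert p c. insert x c \<in> X}. f (insert p c) (insert x c))"
    proof (rule sum.mono_neutral_right)
      show "\<forall>x\<in>(W - insert p c) - {x \<in> W - insert p c. insert x c \<in> X}. f (insert p c) (insert x c) = 0"
        using supp[OF cX(3)] by blast
    qed (use finW in auto)
    moreover have "bd W (f (insert p c)) c =
        f (insert p c) (insert p c) + (\<Sum>x\<in>W - insert p c. f (insert p c) (insert x c))"
    proof -
      have W: "W - c = insert p (W - insert p c)" using p cX by auto
      show ?thesis unfolding bd_def by (subst W, subst sum.insert) (use finW in auto)
    qed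
    moreover have "bd W (f (insert p c)) c = f c c + (\<Sum>x\<in>c. f (insert p (c - {x})) c)"
    proof -
      have "(\<Sum>x\<in>c. f (insert p c - {x}) c) = (\<Sum>x\<in>c. f (insert p (c - {x})) c)"
        using cX(2) by (intro sum.cong) (auto simp: insert_Diff_if)
      then show ?thesis using bd[OF cX(3)] cX(2) finc[OF cX(1)] by simp
    qed
    ultimately have eq: "f (insert p c) (insert p c) +
        (\<Sum>x\<in>{x \<in> W - insert p c. insert x c \<in> X}. f (insert p c) (insert x c)) =
      f c c + (\<Sum>x\<in>c. f (insert p (c - {x})) c)" by simp
    have cancel: "u + a = v + b" if "a + b = u + v" for a b u v :: bit
      using that by (cases a; cases b; cases u; cases v; simp)
    show ?thesis by (rule cancel[OF eq])
  qed
  have "(\<Sum>c\<in>X. f c c) = (\<Sum>c\<in>X0. f c c + f (insert p c) (insert p c))"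
  proof -
    have "X0 \<inter> insert p ` X0 = {}" by (auto simp: X0_def)
    then have "(\<Sum>c\<in>X0 \<union> insert p ` X0. f c c) = (\<Sum>c\<in>X0. f c c) + (\<Sum>c\<in>insert p ` X0. f c c)"
      using fin0 by (intro sum.union_disjoint) auto
    then show ?thesis using X by (simp add: sum.reindex[OF inj] sum.distrib)
  qed
  also have "\<dots> = (\<Sum>c\<in>X0. \<Sum>x\<in>c. f (insert p (c - {x})) c) +
      (\<Sum>c\<in>X0. \<Sum>x\<in>{x \<in> W - insert p c. insert x c \<in> X}. f (insert p c) (insert x c))"
    using step by (simp add: sum.distrib)
  also have "(\<Sum>c\<in>X0. \<Sum>x\<in>c. f (insert p (c - {x})) c) =
      (\<Sum>(c, x)\<in>Sigma X0 (\<lambda>c. c). f (insert p (c - {x})) c)"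
    by (rule sum.Sigma) (use fin0 finc in \<open>auto simp: X0_def\<close>)
  \<comment> \<open>Taking \<open>x\<close> out of \<open>c\<close> on one side and adding it on the
    other matches the two double sums term by term, so they cancel modulo 2.\<close>
  also have "\<dots> = (\<Sum>(c, x)\<in>Sigma X0 (\<lambda>c. {x \<in> W - insert p c. insert x c \<in> X}). f (insert p c) (insert x c))"
  proof (rule sum.reindex_bij_witness[where j = "\<lambda>(c, x). (c - {x}, x)" and i = "\<lambda>(c, x). (insert x c, x)"])
    fix a assume "a \<in> Sigma X0 (\<lambda>c. c)"
    then obtain c x where a: "a = (c, x)" "c \<in> X" "p \<notin> c" "x \<in> c" by (auto simp: X0_def)
    have c: "insert x (c - {x}) = c" using a(4) by blast
    show "(case case a of (c, x) \<Rightarrow> (c - {x}, x) of (c, x) \<Rightarrow> (insert x c, x)) = a"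
      using a(1) c by simp
    have "c - {x} \<in> X" "x \<in> W" using down[OF a(2)] XW a(2,4) by blast+
    then show "(case a of (c, x) \<Rightarrow> (c - {x}, x)) \<in> Sigma X0 (\<lambda>c. {x \<in> W - insert p c. insert x c \<in> X})"
      using a c by (auto simp: X0_def)
    show "(case case a of (c, x) \<Rightarrow> (c - {x}, x) of (c, x) \<Rightarrow> f (insert p c) (insert x c)) =
        (case a of (c, x) \<Rightarrow> f (insert p (c - {x})) c)"
      using a(1) c by simp
  next
    fix b assume "b \<in> Sigma X0 (\<lambda>c. {x \<in> W - insert p c. insert x c \<in> X})"
    then show "(case case b of (c, x) \<Rightarrow> (insert x c, x) of (c, x) \<Rightarrow> (c - {x}, x)) = b"
      "(case b of (c, x) \<Rightarrow> (insert x c, x)) \<in> Sigma X0 (\<lambda>c. c)"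
      by (auto simp: X0_def)
  qed
  also have "\<dots> = (\<Sum>c\<in>X0. \<Sum>x\<in>{x \<in> W - insert p c. insert x c \<in> X}. f (insert p c) (insert x c))"
    by (rule sum.Sigma[symmetric]) (use fin0 finW in auto)
  finally show ?thesis by (simp only: bit_double)
qed

text \<open>A Lefschetz argument modulo 2. The composite of the chain maps carried by
  \<open>\<Gamma>\<close> and \<open>\<Delta>\<close> has trace zero because \<open>X\<close> is a
  cone, while the empty chain contributes 1. So some nonempty \<open>c\<close> has a nonzero
  diagonal entry, and this entry passes through a simplex \<open>\<sigma>\<close> common to both
  carriers.\<close>

theorem carrier_fixed_point:
  fixes \<Gamma> :: "'w set \<Rightarrow> 'v set set" and \<Delta> :: "'v set \<Rightarrow> 'w set set"
  assumes finW: "finite W" and XW: "X \<subseteq> Pow W" and X0: "{} \<in> X"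
    and downX: "\<And>c d. c \<in> X \<Longrightarrow> d \<subseteq> c \<Longrightarrow> d \<in> X"
    and p: "p \<in> W" and apex: "\<And>c. c \<in> X \<Longrightarrow> insert p c \<in> X"
    and finV: "finite V" and KV: "K \<subseteq> Pow V"
    and downK: "\<And>\<sigma> \<tau>. \<sigma> \<in> K \<Longrightarrow> \<tau> \<subseteq> \<sigma> \<Longrightarrow> \<tau> \<in> K"
    and \<Gamma>K: "\<And>c. c \<in> X \<Longrightarrow> \<Gamma> c \<subseteq> K"
    and \<Gamma>mono: "\<And>c d. c \<in> X \<Longrightarrow> d \<subseteq> c \<Longrightarrow> \<Gamma> d \<subseteq> \<Gamma> c"
    and \<Gamma>0: "{} \<in> \<Gamma> {}"
    and \<Gamma>acyc: "\<And>c k. c \<in> X \<Longrightarrow> card c = Suc k \<Longrightarrow> acyclic_at V (\<Gamma> c) k"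
    and \<Delta>X: "\<And>\<sigma>. \<sigma> \<in> K \<Longrightarrow> \<Delta> \<sigma> \<subseteq> X"
    and \<Delta>mono: "\<And>\<sigma> \<tau>. \<sigma> \<in> K \<Longrightarrow> \<tau> \<subseteq> \<sigma> \<Longrightarrow> \<Delta> \<tau> \<subseteq> \<Delta> \<sigma>"
    and \<Delta>0: "{} \<in> \<Delta> {}"
    and \<Delta>acyc: "\<And>\<sigma> k. \<sigma> \<in> K \<Longrightarrow> card \<sigma> = Suc k \<Longrightarrow> acyclic_at W (\<Delta> \<sigma>) k"
  shows "\<exists>c\<in>X. c \<noteq> {} \<and> (\<exists>\<sigma>\<in>\<Gamma> c. c \<in> \<Delta> \<sigma>)"
proof (rule ccontr)
  assume no: "\<not> ?thesis"
  have ex\<Phi>: "\<exists>\<Phi>. \<Phi> {} = (\<lambda>\<tau>. if \<tau> = {} then 1 else 0) \<and>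
    (\<forall>c\<in>X. simplicial_chain (\<Gamma> c) (card c) (\<Phi> c)) \<and>
    (\<forall>c\<in>X. bd V (\<Phi> c) = (\<lambda>\<tau>. \<Sum>x\<in>c. \<Phi> (c - {x}) \<tau>))"
    by (rule carrier_chain_map[OF finV finW XW]) (fact downX \<Gamma>mono \<Gamma>0 \<Gamma>acyc)+
  have ex\<Psi>: "\<exists>\<Psi>. \<Psi> {} = (\<lambda>\<tau>. if \<tau> = {} then 1 else 0) \<and>
    (\<forall>\<sigma>\<in>K. simplicial_chain (\<Delta> \<sigma>) (card \<sigma>) (\<Psi> \<sigma>)) \<and>
    (\<forall>\<sigma>\<in>K. bd W (\<Psi> \<sigma>) = (\<lambda>\<tau>. \<Sum>x\<in>\<sigma>. \<Psi> (\<sigma> - {x}) \<tau>))"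
    by (rule carrier_chain_map[OF finW finV KV]) (fact downK \<Delta>mono \<Delta>0 \<Delta>acyc)+
  obtain \<Phi> where \<Phi>: "\<Phi> {} = (\<lambda>\<tau>. if \<tau> = {} then 1 else 0)"
    "\<forall>c\<in>X. simplicial_chain (\<Gamma> c) (card c) (\<Phi> c)"
    "\<forall>c\<in>X. bd V (\<Phi> c) = (\<lambda>\<tau>. \<Sum>x\<in>c. \<Phi> (c - {x}) \<tau>)"
    using ex\<Phi> by (elim exE conjE) (rule that)
  obtain \<Psi> where \<Psi>: "\<Psi> {} = (\<lambda>\<tau>. if \<tau> = {} then 1 else 0)"
    "\<forall>\<sigma>\<in>K. simplicial_chain (\<Delta> \<sigma>) (card \<sigma>) (\<Psi> \<sigma>)"
    "\<forall>\<sigma>\<in>K. bd W (\<Psi> \<sigma>) = (\<lambda>\<tau>. \<Sum>x\<in>\<sigma>. \<Psi> (\<sigma> - {x}) \<tau>)"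
    using ex\<Psi> by (elim exE conjE) (rule that)
  define f where "f = (\<lambda>c d. \<Sum>\<sigma>\<in>Pow V. \<Phi> c \<sigma> * \<Psi> \<sigma> d)"
  have \<Phi>K: "\<sigma> \<in> \<Gamma> c \<and> \<sigma> \<in> K" if "c \<in> X" "\<Phi> c \<sigma> \<noteq> 0" for c \<sigma>
  proof -
    have "\<sigma> \<in> \<Gamma> c" using bspec[OF \<Phi>(2) that(1)] that(2) by (simp add: simplicial_chain_def)
    then show ?thesis using \<Gamma>K[OF that(1)] by blast
  qed
  have \<Psi>X: "d \<in> \<Delta> \<sigma> \<and> d \<in> X" if "\<sigma> \<in> K" "\<Psi> \<sigma> d \<noteq> 0" for \<sigma> d
  proof -
    have "d \<in> \<Delta> \<sigma>" using bspec[OF \<Psi>(2) that(1)] that(2) by (simp add: simplicial_chain_def)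
    then show ?thesis using \<Delta>X[OF that(1)] by blast
  qed
  have fne: "\<exists>\<sigma>\<in>\<Gamma> c. d \<in> \<Delta> \<sigma> \<and> d \<in> X" if c: "c \<in> X" "f c d \<noteq> 0" for c d
  proof -
    obtain \<sigma> where "\<Phi> c \<sigma> * \<Psi> \<sigma> d \<noteq> 0" using c(2) unfolding f_def by (meson sum.neutral)
    then have "\<Phi> c \<sigma> \<noteq> 0" "\<Psi> \<sigma> d \<noteq> 0" by auto
    then show ?thesis using \<Phi>K[OF c(1)] \<Psi>X by blast
  qed
  have "(\<Sum>c\<in>X. f c c) = 0"
  proof (rule cone_chain_map_trace_zero[where f = f, OF finW XW])
    show "d \<in> X" if "c \<in> X" "f c d \<noteq> 0" for c d using fne[OF that] by blast
    show "bd W (f c) = (\<lambda>d. \<Sum>x\<in>c. f (c - {x}) d)" if "c \<in> X" for c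
      unfolding f_def
    proof (rule chain_map_compose[where K = K, OF finV])
      show "\<sigma> \<in> K" if "\<Phi> c \<sigma> \<noteq> 0" for \<sigma> using \<Phi>K[OF \<open>c \<in> X\<close> that] ..
    qed (use that \<Phi>(3) \<Psi>(3) in simp_all)
  qed (fact downX p apex)+
  moreover have "(\<Sum>c\<in>X. f c c) = (\<Sum>c\<in>{{}}. f c c)"
  proof (rule sum.mono_neutral_right)
    show "finite X" using XW finW by (meson finite_Pow_iff finite_subset)
    show "\<forall>c\<in>X - {{}}. f c c = 0"
    proof
      fix c assume c: "c \<in> X - {{}}"
      then have "\<not> (\<exists>\<sigma>\<in>\<Gamma> c. c \<in> \<Delta> \<sigma>)" using no by blast
      then show "f c c = 0" using fne[of c c] c by (metis DiffD1)
    qed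
  qed (use X0 in auto)
  moreover have "f {} {} = 1"
  proof -
    have "f {} {} = (\<Sum>\<sigma>\<in>Pow V. if \<sigma> = {} then \<Psi> {} {} else 0)"
      unfolding f_def \<Phi>(1) by (intro sum.cong) auto
    then show ?thesis using finV \<Psi>(1) by simp
  qed
  ultimately show False by simp
qed

section \<open>Painting and elimination in oriented matroids\<close>

lemma supp_opposite [simp]: "supp (opposite X) = supp X"
  by (auto simp: supp_def opposite_def)

lemma fst_opposite [simp]: "fst (opposite X) = snd X" and snd_opposite [simp]: "snd (opposite X) = fst X"
  by (auto simp: opposite_def)

lemma opposite_opposite [simp]: "opposite (opposite X) = X"
  by (simp add: opposite_def)

lemma restriction_opposite: "restriction (opposite X) A = opposite (restriction X A)"
  by (simp add: restriction_def opposite_def)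

lemma om_opposite: "oriented_matroid E \<C> \<Longrightarrow> X \<in> \<C> \<Longrightarrow> opposite X \<in> \<C>"
  by (auto simp: oriented_matroid_def)

lemma om_signed: "oriented_matroid E \<C> \<Longrightarrow> X \<in> \<C> \<Longrightarrow> fst X \<subseteq> E \<and> snd X \<subseteq> E \<and> fst X \<inter> snd X = {}"
  by (auto simp: oriented_matroid_def signed_subset_def)

lemma om_supp_finite: "oriented_matroid E \<C> \<Longrightarrow> X \<in> \<C> \<Longrightarrow> finite (supp X)"
  using om_signed[of E \<C> X] by (auto simp: supp_def oriented_matroid_def intro: finite_subset)

lemma om_weak_elimination:
  assumes "oriented_matroid E \<C>" "X \<in> \<C>" "Y \<in> \<C>" "X \<noteq> opposite Y"
    and "e \<in> fst X \<inter> snd Y \<or> e \<in> snd X \<inter> fst Y"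
  obtains Z where "Z \<in> \<C>" "fst Z \<subseteq> (fst X \<union> fst Y) - {e}" "snd Z \<subseteq> (snd X \<union> snd Y) - {e}"
proof -
  have ax: "\<And>X Y. X \<in> \<C> \<Longrightarrow> Y \<in> \<C> \<Longrightarrow> X \<noteq> opposite Y \<Longrightarrow> e \<in> fst X \<inter> snd Y \<Longrightarrow>
     \<exists>Z \<in> \<C>. fst Z \<subseteq> (fst X \<union> fst Y) - {e} \<and> snd Z \<subseteq> (snd X \<union> snd Y) - {e}"
    using assms(1) unfolding oriented_matroid_def by blast
  show thesis
  proof (cases "e \<in> fst X \<inter> snd Y")
    case True
    then show ?thesis using ax[OF assms(2,3,4)] that by blast
  next
    case False
    moreover have "Y \<noteq> opposite X" using assms(4) by auto
    ultimately show ?thesis using ax[OF assms(3,2)] assms(5) that by (metis IntD1 IntD2 IntI Un_commute)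
  qed
qed

text \<open>Weak elimination may lose \<open>f\<close> and produce \<open>Z1\<close>. Then some \<open>g\<close> in \<open>Z1\<close> but not in \<open>X\<close> is
  eliminated between \<open>Y\<close> and \<open>opposite Z1\<close>, keeping \<open>e\<close>, and \<open>e\<close> is eliminated between the result
  and \<open>X\<close>, keeping \<open>f\<close>; the summand for \<open>f \<in> supp Y\<close> in the measure makes both recursive calls
  legitimate.\<close>

lemma om_strong_elimination:
  assumes om: "oriented_matroid E \<C>"
  shows "X \<in> \<C> \<Longrightarrow> Y \<in> \<C> \<Longrightarrow> e \<in> fst X \<inter> snd Y \<or> e \<in> snd X \<inter> fst Y \<Longrightarrow>
    f \<in> fst X - snd Y \<Longrightarrow>
    \<exists>Z \<in> \<C>. f \<in> fst Z \<and> fst Z \<subseteq> (fst X \<union> fst Y) - {e} \<and> snd Z \<subseteq> (snd X \<union> snd Y) - {e}"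
proof (induction "2 * card (supp X \<union> supp Y) + (if f \<in> supp Y then 1 else 0)"
    arbitrary: X Y e f rule: less_induct)
  case less
  note sg = om_signed[OF om]
  have finXY: "finite (supp X \<union> supp Y)" using om_supp_finite[OF om] less.prems by blast
  let ?n = "2 * card (supp X \<union> supp Y) + (if f \<in> supp Y then 1 else 0)"
  let ?U = "supp X \<union> supp Y"
  have small: "2 * card U + i < ?n" if "U \<subseteq> ?U" "x \<in> ?U" "x \<notin> U" "i \<le> 1" for U x and i :: nat
  proof -
    have "card U < card ?U" using that finXY by (metis psubset_card_mono psubsetI)
    then show ?thesis using that(4) by simp
  qed
  have ne: "X \<noteq> opposite Y" using less.prems by auto
  obtain Z1 where Z1: "Z1 \<in> \<C>" "fst Z1 \<subseteq> (fst X \<union> fst Y) - {e}" "snd Z1 \<subseteq> (snd X \<union> snd Y) - {e}"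
    using om_weak_elimination[OF om less.prems(1,2) ne less.prems(3)] .
  show ?case
  proof (cases "f \<in> supp Z1")
    case True
    then have "f \<in> fst Z1"
      using Z1 less.prems(4) sg[OF less.prems(1)] by (auto simp: supp_def)
    then show ?thesis using Z1 by blast
  next
    case fZ1: False
    have eZ1: "e \<notin> supp Z1" using Z1 by (auto simp: supp_def)
    have Z1U: "supp Z1 \<subseteq> ?U" using Z1 by (auto simp: supp_def)
    have eXY: "e \<in> supp X" "e \<in> supp Y" using less.prems(3) by (auto simp: supp_def)
    have "\<not> supp Z1 \<subseteq> supp X"
    proof
      assume "supp Z1 \<subseteq> supp X"
      then have "Z1 = X \<or> Z1 = opposite X"
        using om Z1(1) less.prems(1) unfolding oriented_matroid_def by blast
      then show False using eZ1 eXY by auto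
    qed
    then obtain g where g: "g \<in> supp Z1" "g \<notin> supp X" by blast
    have gY: "g \<in> fst Z1 \<and> g \<in> fst Y \<or> g \<in> snd Z1 \<and> g \<in> snd Y"
      using g Z1 by (auto simp: supp_def)
    have IHm: "2 * card (supp Y \<union> supp Z1) + (if e \<in> supp Z1 then 1 else 0) < ?n"
    proof (cases "f \<in> supp Y")
      case True
      then have "supp Y \<union> supp Z1 \<subseteq> ?U" using Z1U by blast
      then have "card (supp Y \<union> supp Z1) \<le> card ?U" using finXY by (rule card_mono[rotated])
      then show ?thesis using True eZ1 by simp
    next
      case False
      then show ?thesis
        using small[of "supp Y \<union> supp Z1" f 0] fZ1 Z1U less.prems(4) eZ1 by (auto simp: supp_def)
    qed
    \<comment> \<open>The induction hypothesis preserves an element of a positive part, so the case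
      \<open>e \<in> snd Y\<close> is run on \<open>opposite Y\<close> and \<open>Z1\<close> and the
      result is reversed.\<close>
    obtain W where W: "W \<in> \<C>" "fst W \<subseteq> (fst Y \<union> snd Z1) - {g}" "snd W \<subseteq> (snd Y \<union> fst Z1) - {g}"
      and eW: "e \<in> fst X \<inter> snd W \<or> e \<in> snd X \<inter> fst W"
    proof (cases "e \<in> fst X \<inter> snd Y")
      case True
      have "\<exists>Z \<in> \<C>. e \<in> fst Z \<and> fst Z \<subseteq> (fst (opposite Y) \<union> fst Z1) - {g} \<and>
          snd Z \<subseteq> (snd (opposite Y) \<union> snd Z1) - {g}"
      proof (rule less.hyps)
        show "2 * card (supp (opposite Y) \<union> supp Z1) + (if e \<in> supp Z1 then 1 else 0) < ?n"
          using IHm by simp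
        show "opposite Y \<in> \<C>" using om_opposite[OF om less.prems(2)] .
      qed (use Z1(1) True eZ1 gY in \<open>auto simp: supp_def\<close>)
      then obtain W' where W': "W' \<in> \<C>" "e \<in> fst W'" "fst W' \<subseteq> (snd Y \<union> fst Z1) - {g}"
        "snd W' \<subseteq> (fst Y \<union> snd Z1) - {g}" by auto
      show ?thesis
        by (rule that[of "opposite W'"]) (use W' om_opposite[OF om] True in auto)
    next
      case False
      then have e: "e \<in> snd X \<inter> fst Y" using less.prems(3) by blast
      have "\<exists>Z \<in> \<C>. e \<in> fst Z \<and> fst Z \<subseteq> (fst Y \<union> fst (opposite Z1)) - {g} \<and>
          snd Z \<subseteq> (snd Y \<union> snd (opposite Z1)) - {g}"
      proof (rule less.hyps)
        show "2 * card (supp Y \<union> supp (opposite Z1)) + (if e \<in> supp (opposite Z1) then 1 else 0) < ?n"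
          using IHm by simp
        show "opposite Z1 \<in> \<C>" using om_opposite[OF om Z1(1)] .
      qed (use less.prems(2) e eZ1 gY in \<open>auto simp: supp_def\<close>)
      then obtain W' where "W' \<in> \<C>" "e \<in> fst W'" "fst W' \<subseteq> (fst Y \<union> snd Z1) - {g}"
        "snd W' \<subseteq> (snd Y \<union> fst Z1) - {g}" by auto
      then show ?thesis using that[of W'] e by blast
    qed
    have "supp X \<union> supp W \<subseteq> ?U" "g \<notin> supp X \<union> supp W" "g \<in> ?U"
      using W(2,3) Z1U g by (auto simp: supp_def)
    moreover have "(if f \<in> supp W then 1 else 0) \<le> (1::nat)" by simp
    ultimately have IHm2: "2 * card (supp X \<union> supp W) + (if f \<in> supp W then 1 else 0) < ?n"
      using small by blast
    have "\<exists>Z \<in> \<C>. f \<in> fst Z \<and> fst Z \<subseteq> (fst X \<union> fst W) - {e} \<and> snd Z \<subseteq> (snd X \<union> snd W) - {e}"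
      by (rule less.hyps[OF IHm2])
        (use less.prems W eW fZ1 in \<open>auto simp: supp_def\<close>)
    then obtain V where V: "V \<in> \<C>" "f \<in> fst V" "fst V \<subseteq> (fst X \<union> fst Y \<union> snd Z1) - {e}"
      "snd V \<subseteq> (snd X \<union> snd Y \<union> fst Z1) - {e}"
      using W(2,3) by blast
    \<comment> \<open>The wrong signs of \<open>V\<close> all come from \<open>opposite Z1\<close>, so they are removed by eliminating
      with \<open>Z1\<close>, which introduces only correct ones.\<close>
    let ?bad = "\<lambda>V. (fst V - (fst X \<union> fst Y)) \<union> (snd V - (snd X \<union> snd Y))"
    show ?thesis
      using V
    proof (induction "card (?bad V)" arbitrary: V rule: less_induct)
      case inner: less
      show ?case
      proof (cases "?bad V = {}")
        case True
        then show ?thesis using inner.prems by blast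
      next
        case False
        then obtain k where k: "k \<in> ?bad V" by blast
        have kZ: "k \<in> fst V \<inter> snd Z1 \<or> k \<in> snd V \<inter> fst Z1"
          using k inner.prems(3,4) by blast
        have VU: "supp V \<union> supp Z1 \<subseteq> ?U" "e \<notin> supp V \<union> supp Z1"
          using inner.prems(3,4) Z1U eZ1 by (auto simp: supp_def)
        have IHm3: "2 * card (supp V \<union> supp Z1) + (if f \<in> supp Z1 then 1 else 0) < ?n"
          using small[OF VU(1) _ VU(2), of 0] eXY fZ1 by simp
        have "\<exists>Z \<in> \<C>. f \<in> fst Z \<and> fst Z \<subseteq> (fst V \<union> fst Z1) - {k} \<and> snd Z \<subseteq> (snd V \<union> snd Z1) - {k}"
          by (rule less.hyps[OF IHm3])
            (use inner.prems Z1(1) kZ fZ1 in \<open>auto simp: supp_def\<close>)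
        then obtain V' where V': "V' \<in> \<C>" "f \<in> fst V'" "fst V' \<subseteq> (fst V \<union> fst Z1) - {k}"
          "snd V' \<subseteq> (snd V \<union> snd Z1) - {k}" by blast
        have "?bad V' \<subseteq> ?bad V - {k}" using V'(3,4) Z1(2,3) by blast
        moreover have "finite (?bad V)"
          using om_supp_finite[OF om inner.prems(1)] by (auto simp: supp_def)
        ultimately have "card (?bad V') < card (?bad V)"
          using k by (meson card_Diff1_less card_mono finite_Diff le_less_trans)
        then show ?thesis
          by (rule inner.hyps) (use V' inner.prems(3,4) Z1(2,3) in blast)+
      qed
    qed
  qed
qed

section \<open>Orthogonality of circuits and covectors\<close>

lemma orthogonalD:
  assumes "orthogonal X Y" "fst X \<inter> snd X = {}" "fst Y \<inter> snd Y = {}"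
    and "e \<in> fst X \<inter> fst Y \<or> e \<in> snd X \<inter> snd Y"
  shows "\<exists>h. h \<in> fst X \<inter> snd Y \<or> h \<in> snd X \<inter> fst Y"
proof (rule ccontr)
  assume no: "\<not> ?thesis"
  have "supp X \<inter> supp Y \<noteq> {}" using assms(4) by (auto simp: supp_def)
  moreover have "restriction X (supp X \<inter> supp Y) = restriction Y (supp X \<inter> supp Y)"
    using no assms(2,3) by (auto simp: restriction_def supp_def)
  ultimately show False using assms(1) by (simp add: orthogonal_def)
qed

lemma covector_signed: "Y \<in> covectors E \<C> \<Longrightarrow> fst Y \<subseteq> E \<and> snd Y \<subseteq> E \<and> fst Y \<inter> snd Y = {}"
  by (auto simp: covectors_def signed_subset_def)

lemma covector_opposite:
  assumes "Y \<in> covectors E \<C>" shows "opposite Y \<in> covectors E \<C>"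
proof -
  have "orthogonal X (opposite Y)" if "orthogonal X Y" for X
    using that by (auto simp: orthogonal_def restriction_opposite)
  then show ?thesis using assms by (auto simp: covectors_def signed_subset_def)
qed

lemma circuit_covector_same:
  assumes "oriented_matroid E \<C>" "X \<in> \<C>" "Y \<in> covectors E \<C>"
    and "e \<in> fst X \<inter> fst Y \<or> e \<in> snd X \<inter> snd Y"
  shows "\<exists>h. h \<in> fst X \<inter> snd Y \<or> h \<in> snd X \<inter> fst Y"
  using orthogonalD[of X Y] om_signed[OF assms(1,2)] covector_signed[OF assms(3)] assms
  by (auto simp: covectors_def)

text \<open>The unsigned shadow of orthogonality; reversing the covector reduces opposite signs at
  \<open>e\<close> to equal ones. The exchange argument for ranks uses orthogonality in this
  form.\<close>

lemma circuit_covector_other: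
  assumes om: "oriented_matroid E \<C>" and X: "X \<in> \<C>" and Y: "Y \<in> covectors E \<C>"
    and "e \<in> supp X" "e \<in> supp Y"
  shows "\<exists>h. h \<noteq> e \<and> h \<in> supp X \<inter> supp Y"
proof -
  have sg: "fst X \<inter> snd X = {}" "fst Y \<inter> snd Y = {}"
    using om_signed[OF om X] covector_signed[OF Y] by auto
  show ?thesis
  proof (cases "e \<in> fst X \<inter> fst Y \<or> e \<in> snd X \<inter> snd Y")
    case True
    then show ?thesis using circuit_covector_same[OF om X Y True] sg by (auto simp: supp_def)
  next
    case False
    then have e: "e \<in> fst X \<inter> fst (opposite Y) \<or> e \<in> snd X \<inter> snd (opposite Y)"
      using assms by (auto simp: supp_def)
    then show ?thesis
      using circuit_covector_same[OF om X covector_opposite[OF Y] e] sg by (auto simp: supp_def)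
  qed
qed

section \<open>The painting lemma and elimination of covectors\<close>

definition bad_circuit :: "'a signed set \<Rightarrow> 'a set \<Rightarrow> 'a set \<Rightarrow> 'a set \<Rightarrow> 'a signed \<Rightarrow> bool" where
  "bad_circuit \<C> P N F X \<longleftrightarrow> X \<in> \<C> \<and> fst X \<subseteq> P \<union> F \<and> snd X \<subseteq> N \<union> F"

text \<open>If no bad circuit meets \<open>P \<union> N\<close>, then \<open>(P, N)\<close> itself
  is a covector. Otherwise an element \<open>t\<close> of such a circuit is moved to
  \<open>F\<close>. A bad circuit through \<open>s\<close> for the new painting would have to use
  \<open>t\<close> with the wrong sign, and strong elimination of \<open>t\<close> would turn it
  into a bad circuit for the old painting, still through \<open>s\<close>.\<close>

lemma covector_of_full_painting:
  assumes om: "oriented_matroid E \<C>"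
  shows "P \<union> N \<union> F = E \<Longrightarrow> P \<inter> N = {} \<Longrightarrow> P \<inter> F = {} \<Longrightarrow> N \<inter> F = {} \<Longrightarrow> s \<in> P \<Longrightarrow>
    \<nexists>X. bad_circuit \<C> P N F X \<and> s \<in> fst X \<Longrightarrow>
    \<exists>U \<in> covectors E \<C>. s \<in> fst U \<and> fst U \<subseteq> P \<and> snd U \<subseteq> N"
proof (induction "card (P \<union> N)" arbitrary: P N F rule: less_induct)
  case less
  have finE: "finite E" using om by (simp add: oriented_matroid_def)
  then have finPN: "finite (P \<union> N)" using less.prems(1) by (metis finite_Un)
  show ?case
  proof (cases "\<exists>X t. bad_circuit \<C> P N F X \<and> (t \<in> P \<inter> fst X \<or> t \<in> N \<inter> snd X)")
    case False
    have "orthogonal X (P, N)" if X: "X \<in> \<C>" for X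
    proof (rule ccontr)
      assume no: "\<not> orthogonal X (P, N)"
      let ?S = "supp X \<inter> supp (P, N)"
      have ne: "?S \<noteq> {}" and
        "restriction X ?S = restriction (P, N) ?S \<or> restriction X ?S = opposite (restriction (P, N) ?S)"
        using no unfolding orthogonal_def by auto
      then consider "restriction X ?S = restriction (P, N) ?S"
        | "restriction X ?S = opposite (restriction (P, N) ?S)" by blast
      then obtain X' where X': "X' \<in> \<C>" "supp X' = supp X" "restriction X' ?S = restriction (P, N) ?S"
      proof cases
        assume "restriction X ?S = opposite (restriction (P, N) ?S)"
        then have "restriction (opposite X) ?S = restriction (P, N) ?S"
          by (auto simp: restriction_def opposite_def)
        then show ?thesis using that[of "opposite X"] om_opposite[OF om X] by simp
      qed (use X that in blast)
      have E: "fst X' \<subseteq> E" "snd X' \<subseteq> E" using om_signed[OF om X'(1)] by auto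
      have res: "fst X' \<inter> ?S = P \<inter> ?S" "snd X' \<inter> ?S = N \<inter> ?S"
        using X'(3) by (auto simp: restriction_def)
      have S: "x \<in> ?S \<longleftrightarrow> (x \<in> fst X' \<or> x \<in> snd X') \<and> (x \<in> P \<or> x \<in> N)" for x
        using X'(2) by (auto simp: supp_def)
      have "fst X' \<subseteq> P \<union> F" using E res(1) S less.prems(1) by blast
      moreover have "snd X' \<subseteq> N \<union> F" using E res(2) S less.prems(1) by blast
      ultimately have b: "bad_circuit \<C> P N F X'" using X' by (simp add: bad_circuit_def)
      obtain t where "t \<in> ?S" using ne by blast
      then have "t \<in> P \<inter> fst X' \<or> t \<in> N \<inter> snd X'" using S res by blast
      then show False using b False by blast
    qed
    then have "(P, N) \<in> covectors E \<C>"
      using less.prems by (auto simp: covectors_def signed_subset_def)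
    then show ?thesis using less.prems by (intro bexI[of _ "(P, N)"]) auto
  next
    case True
    then obtain X t where X: "bad_circuit \<C> P N F X" and t: "t \<in> P \<inter> fst X \<or> t \<in> N \<inter> snd X"
      by blast
    have sX: "s \<notin> fst X" "s \<notin> snd X"
      using X less.prems by (auto simp: bad_circuit_def)
    have st: "s \<noteq> t" using t sX by blast
    have tPN: "t \<in> P \<union> N" using t by blast
    have "\<nexists>X. bad_circuit \<C> (P - {t}) (N - {t}) (insert t F) X \<and> s \<in> fst X"
    proof
      assume "\<exists>X. bad_circuit \<C> (P - {t}) (N - {t}) (insert t F) X \<and> s \<in> fst X"
      then obtain X' where X': "bad_circuit \<C> (P - {t}) (N - {t}) (insert t F) X'" "s \<in> fst X'"
        by blast
      have "\<not> bad_circuit \<C> P N F X'" using less.prems X' by blast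
      then have "t \<in> fst X' \<inter> snd X \<or> t \<in> snd X' \<inter> fst X"
        using X'(1) t unfolding bad_circuit_def by blast
      then obtain Z where Z: "Z \<in> \<C>" "s \<in> fst Z" "fst Z \<subseteq> (fst X' \<union> fst X) - {t}"
        "snd Z \<subseteq> (snd X' \<union> snd X) - {t}"
        using om_strong_elimination[OF om, of X' X t s] X X' sX by (auto simp: bad_circuit_def)
      then have "bad_circuit \<C> P N F Z" using X X'(1) unfolding bad_circuit_def by blast
      then show False using Z less.prems by blast
    qed
    moreover have "card ((P - {t}) \<union> (N - {t})) < card (P \<union> N)"
      using tPN finPN by (intro psubset_card_mono) auto
    ultimately have "\<exists>U \<in> covectors E \<C>. s \<in> fst U \<and> fst U \<subseteq> P - {t} \<and> snd U \<subseteq> N - {t}"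
      by (intro less.hyps[of _ _ "insert t F"]) (use less.prems tPN st in auto)
    then show ?thesis by blast
  qed
qed

text \<open>An oriented Farkas lemma. Elements outside \<open>P \<union> N \<union> F\<close> form a
  fourth colour: absent from the circuit, unconstrained for the covector. Such an element
  \<open>g\<close> is painted positive and painted negative; if neither painting has a covector, the
  two circuits carry opposite signs at \<open>g\<close>, and eliminating \<open>g\<close> while
  keeping \<open>s\<close> gives a circuit for the original painting.\<close>

lemma painting:
  assumes om: "oriented_matroid E \<C>"
    and "P \<union> N \<union> F \<subseteq> E" "P \<inter> N = {}" "P \<inter> F = {}" "N \<inter> F = {}" "s \<in> P"
  shows "(\<exists>X \<in> \<C>. s \<in> fst X \<and> fst X \<subseteq> P \<union> F \<and> snd X \<subseteq> N \<union> F) \<or>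
    (\<exists>U \<in> covectors E \<C>. s \<in> fst U \<and> fst U \<inter> (N \<union> F) = {} \<and> snd U \<inter> (P \<union> F) = {})"
  using assms(2-)
proof (induction "card (E - (P \<union> N \<union> F))" arbitrary: P N)
  case 0
  have "finite E" using om by (simp add: oriented_matroid_def)
  then have "P \<union> N \<union> F = E" using 0 by auto
  note E = this
  show ?case
  proof (cases "\<exists>X. bad_circuit \<C> P N F X \<and> s \<in> fst X")
    case True
    then show ?thesis unfolding bad_circuit_def by blast
  next
    case False
    then obtain U where U: "U \<in> covectors E \<C>" "s \<in> fst U" "fst U \<subseteq> P" "snd U \<subseteq> N"
      using covector_of_full_painting[OF om E] 0 by blast
    then have "fst U \<inter> (N \<union> F) = {}" "snd U \<inter> (P \<union> F) = {}" using 0 by blast+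
    then show ?thesis using U by blast
  qed
next
  case (Suc n)
  then obtain g where g: "g \<in> E - (P \<union> N \<union> F)" by (metis card_eq_SucD insertI1)
  have n: "n = card (E - (insert g P \<union> N \<union> F))" "n = card (E - (P \<union> insert g N \<union> F))"
  proof -
    have "E - (insert g P \<union> N \<union> F) = (E - (P \<union> N \<union> F)) - {g}"
      "E - (P \<union> insert g N \<union> F) = (E - (P \<union> N \<union> F)) - {g}" by auto
    then show "n = card (E - (insert g P \<union> N \<union> F))" "n = card (E - (P \<union> insert g N \<union> F))"
      using Suc(2) g by (simp_all add: card_Diff_singleton)
  qed
  have *: "(\<exists>X \<in> \<C>. s \<in> fst X \<and> fst X \<subseteq> insert g P \<union> F \<and> snd X \<subseteq> N \<union> F) \<or>
    (\<exists>U \<in> covectors E \<C>. s \<in> fst U \<and> fst U \<inter> (N \<union> F) = {} \<and> snd U \<inter> (insert g P \<union> F) = {})"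
    using Suc(1)[OF n(1)] Suc.prems g by auto
  have **: "(\<exists>X \<in> \<C>. s \<in> fst X \<and> fst X \<subseteq> P \<union> F \<and> snd X \<subseteq> insert g N \<union> F) \<or>
    (\<exists>U \<in> covectors E \<C>. s \<in> fst U \<and> fst U \<inter> (insert g N \<union> F) = {} \<and> snd U \<inter> (P \<union> F) = {})"
    using Suc(1)[OF n(2)] Suc.prems g by auto
  show ?case
  proof (rule ccontr)
    assume no: "\<not> ?thesis"
    then have no1: "\<And>X. X \<in> \<C> \<Longrightarrow> s \<in> fst X \<Longrightarrow> fst X \<subseteq> P \<union> F \<Longrightarrow> \<not> snd X \<subseteq> N \<union> F"
      and no2: "\<And>U. U \<in> covectors E \<C> \<Longrightarrow> s \<in> fst U \<Longrightarrow> fst U \<inter> (N \<union> F) = {} \<Longrightarrow>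
        snd U \<inter> (P \<union> F) \<noteq> {}" by simp_all
    from * obtain X where X: "X \<in> \<C>" "s \<in> fst X" "fst X \<subseteq> insert g P \<union> F" "snd X \<subseteq> N \<union> F"
    proof
      assume "\<exists>U \<in> covectors E \<C>. s \<in> fst U \<and> fst U \<inter> (N \<union> F) = {} \<and> snd U \<inter> (insert g P \<union> F) = {}"
      then obtain U where "U \<in> covectors E \<C>" "s \<in> fst U" "fst U \<inter> (N \<union> F) = {}"
        "snd U \<inter> (insert g P \<union> F) = {}" by blast
      then show thesis using no2[of U] by auto
    qed (use that in blast)
    from ** obtain Y where Y: "Y \<in> \<C>" "s \<in> fst Y" "fst Y \<subseteq> P \<union> F" "snd Y \<subseteq> insert g N \<union> F"
    proof
      assume "\<exists>U \<in> covectors E \<C>. s \<in> fst U \<and> fst U \<inter> (insert g N \<union> F) = {} \<and> snd U \<inter> (P \<union> F) = {}"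
      then obtain U where "U \<in> covectors E \<C>" "s \<in> fst U" "fst U \<inter> (insert g N \<union> F) = {}"
        "snd U \<inter> (P \<union> F) = {}" by blast
      then show thesis using no2[of U] by auto
    qed (use that in blast)
    have "g \<in> fst X" using no1[OF X(1,2)] X(3,4) by blast
    moreover have "g \<in> snd Y" using no1[OF Y(1,2,3)] Y(4) by blast
    moreover have "s \<in> fst X - snd Y" using X(2) Y(2) om_signed[OF om Y(1)] by blast
    ultimately obtain Z where Z: "Z \<in> \<C>" "s \<in> fst Z" "fst Z \<subseteq> (fst X \<union> fst Y) - {g}"
      "snd Z \<subseteq> (snd X \<union> snd Y) - {g}"
      using om_strong_elimination[OF om X(1) Y(1), of g s] by blast
    have "fst Z \<subseteq> P \<union> F" using Z(3) X(3) Y(3) by blast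
    moreover have "snd Z \<subseteq> N \<union> F" using Z(4) X(4) Y(4) by blast
    ultimately show False using no1[OF Z(1,2)] by blast
  qed
qed

text \<open>Painting is applied to the combined signs, with \<open>g\<close> made to vanish and the
  other elements of conflicting sign left in the fourth colour. The circuit alternative fails by
  orthogonality: \<open>Y\<close> forces \<open>g\<close> to be negative in the circuit, and
  \<open>W\<close> then forces a disagreement that the painting excludes.\<close>

lemma covector_elimination:
  assumes om: "oriented_matroid E \<C>" and Y: "Y \<in> covectors E \<C>" and W: "W \<in> covectors E \<C>"
    and g: "g \<in> fst Y \<inter> snd W" and s: "s \<in> fst Y - snd W"
  obtains U where "U \<in> covectors E \<C>" "s \<in> fst U" "fst U \<subseteq> (fst Y \<union> fst W) - {g}"
    "snd U \<subseteq> (snd Y \<union> snd W) - {g}"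
proof -
  let ?p = "fst Y \<union> fst W" and ?n = "snd Y \<union> snd W"
  let ?P = "?p - ?n" and ?N = "?n - ?p" and ?F = "insert g (E - (?p \<union> ?n))"
  have sg: "fst Y \<inter> snd Y = {}" "fst W \<inter> snd W = {}" "fst Y \<subseteq> E" "snd Y \<subseteq> E" "fst W \<subseteq> E" "snd W \<subseteq> E"
    using covector_signed[OF Y] covector_signed[OF W] by auto
  have "(\<exists>X \<in> \<C>. s \<in> fst X \<and> fst X \<subseteq> ?P \<union> ?F \<and> snd X \<subseteq> ?N \<union> ?F) \<or>
    (\<exists>U \<in> covectors E \<C>. s \<in> fst U \<and> fst U \<inter> (?N \<union> ?F) = {} \<and> snd U \<inter> (?P \<union> ?F) = {})"
    by (rule painting[OF om]) (use sg g s in auto)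
  then show thesis
  proof
    assume "\<exists>X \<in> \<C>. s \<in> fst X \<and> fst X \<subseteq> ?P \<union> ?F \<and> snd X \<subseteq> ?N \<union> ?F"
    then obtain X where X: "X \<in> \<C>" "s \<in> fst X" "fst X \<subseteq> ?P \<union> ?F" "snd X \<subseteq> ?N \<union> ?F" by blast
    obtain h where "h \<in> fst X \<inter> snd Y \<or> h \<in> snd X \<inter> fst Y"
      using circuit_covector_same[OF om X(1) Y, of s] X(2) s by blast
    then have gX: "g \<in> snd X" using X(3,4) g sg by blast
    then obtain k where "k \<in> fst X \<inter> snd W \<or> k \<in> snd X \<inter> fst W"
      using circuit_covector_same[OF om X(1) W, of g] g by blast
    then have False using X(3,4) gX g sg om_signed[OF om X(1)] by blast
    then show thesis ..
  next
    assume "\<exists>U \<in> covectors E \<C>. s \<in> fst U \<and> fst U \<inter> (?N \<union> ?F) = {} \<and> snd U \<inter> (?P \<union> ?F) = {}"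
    then obtain U where U: "U \<in> covectors E \<C>" "s \<in> fst U" "fst U \<inter> (?N \<union> ?F) = {}"
      "snd U \<inter> (?P \<union> ?F) = {}" by blast
    have "fst U \<subseteq> E" "snd U \<subseteq> E" using covector_signed[OF U(1)] by auto
    then show thesis using U by (intro that[of U]) blast+
  qed
qed

text \<open>A negative element of \<open>Z\<close> is eliminated against \<open>Y\<close>: the
  negative part shrinks, the support stays properly inside that of \<open>Y\<close>, and an element
  \<open>s\<close> of \<open>Y\<close> outside \<open>supp Z\<close> keeps the result nonzero. Hence
  minimal support among nonnegative covectors is minimal support among all nonzero
  covectors.\<close>

lemma nonneg_covector_smaller:
  assumes om: "oriented_matroid E \<C>" and Y: "Y \<in> covectors E \<C>" "snd Y = {}"
  shows "Z \<in> covectors E \<C> \<Longrightarrow> supp Z \<noteq> {} \<Longrightarrow> supp Z \<subset> supp Y \<Longrightarrow>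
    \<exists>U \<in> covectors E \<C>. supp U \<noteq> {} \<and> supp U \<subset> supp Y \<and> snd U = {}"
proof (induction "card (snd Z)" arbitrary: Z rule: less_induct)
  case less
  show ?case
  proof (cases "snd Z = {}")
    case True then show ?thesis using less.prems by blast
  next
    case False
    then obtain g where g: "g \<in> snd Z" by blast
    then have gY: "g \<in> fst Y" using less.prems(3) Y(2) by (auto simp: supp_def)
    obtain s where s: "s \<in> fst Y" "s \<notin> supp Z" using less.prems(3) Y(2) by (auto simp: supp_def)
    obtain U where U: "U \<in> covectors E \<C>" "s \<in> fst U" "fst U \<subseteq> (fst Y \<union> fst Z) - {g}"
      "snd U \<subseteq> (snd Y \<union> snd Z) - {g}"
      using covector_elimination[OF om Y(1) less.prems(1), of g s] g gY s by (auto simp: supp_def)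
    have "finite E" using om by (simp add: oriented_matroid_def)
    then have "finite (snd Z)" using covector_signed[OF less.prems(1)] finite_subset by blast
    moreover have "snd U \<subset> snd Z" using U(4) Y(2) g by blast
    ultimately have "card (snd U) < card (snd Z)" by (rule psubset_card_mono)
    moreover have "supp U \<noteq> {}" "supp U \<subset> supp Y"
      using U g gY less.prems(3) Y(2) by (auto simp: supp_def)
    ultimately show ?thesis using less.hyps U(1) by blast
  qed
qed

lemma nonneg_covector_positive_cocircuit:
  assumes om: "oriented_matroid E \<C>"
  shows "Y \<in> covectors E \<C> \<Longrightarrow> snd Y = {} \<Longrightarrow> supp Y \<noteq> {} \<Longrightarrow>
    \<exists>C. positive_cocircuit E \<C> C \<and> supp C \<subseteq> supp Y"
proof (induction "card (supp Y)" arbitrary: Y rule: less_induct)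
  case less
  show ?case
  proof (cases "Y \<in> cocircuits E \<C>")
    case True then show ?thesis using less.prems unfolding positive_cocircuit_def by blast
  next
    case False
    then obtain Z where "Z \<in> covectors E \<C>" "supp Z \<noteq> {}" "supp Z \<subset> supp Y"
      using less.prems unfolding cocircuits_def by blast
    then obtain U where U: "U \<in> covectors E \<C>" "supp U \<noteq> {}" "supp U \<subset> supp Y" "snd U = {}"
      using nonneg_covector_smaller[OF om less.prems(1,2)] by blast
    have "finite E" using om by (simp add: oriented_matroid_def)
    then have "finite (supp Y)"
      using covector_signed[OF less.prems(1)] by (auto simp: supp_def intro: finite_subset)
    then have "card (supp U) < card (supp Y)" using U(3) by (rule psubset_card_mono)
    then show ?thesis using less.hyps[OF _ U(1,4,2)] U(3) by blast
  qed
qed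

section \<open>Faces of the nonnegative cone\<close>

lemma matroid_rank_attained:
  assumes "finite S" "indep {}"
  obtains B where "B \<subseteq> S" "indep B" "card B = matroid_rank indep S"
proof -
  have "finite {card B | B. B \<subseteq> S \<and> indep B}" using assms(1) by simp
  moreover have "{card B | B. B \<subseteq> S \<and> indep B} \<noteq> {}" using assms(2) by auto
  ultimately have "matroid_rank indep S \<in> {card B | B. B \<subseteq> S \<and> indep B}"
    unfolding matroid_rank_def by (rule Max_in)
  then show thesis using that by auto
qed

lemma card_le_matroid_rank:
  assumes "finite S" "B \<subseteq> S" "indep B"
  shows "card B \<le> matroid_rank indep S"
  unfolding matroid_rank_def by (rule Max_ge) (use assms in auto)

lemma matroid_rank_mono:
  assumes "finite T" "S \<subseteq> T" "indep {}"
  shows "matroid_rank indep S \<le> matroid_rank indep T"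
proof -
  have "finite S" using assms finite_subset by blast
  then obtain B where "B \<subseteq> S" "indep B" "card B = matroid_rank indep S"
    using matroid_rank_attained[of S indep] assms(3) by blast
  then show ?thesis using card_le_matroid_rank[of T B indep] assms by auto
qed

lemma matroid_rank_le_card:
  assumes "finite S" "indep {}"
  shows "matroid_rank indep S \<le> card S"
  using matroid_rank_attained[of S indep, OF assms] card_mono[OF assms(1)] by metis

lemma matroid_rank_insert_le:
  assumes "finite S" "indep {}" "\<And>A B. indep A \<Longrightarrow> B \<subseteq> A \<Longrightarrow> indep B"
  shows "matroid_rank indep (insert a S) \<le> Suc (matroid_rank indep S)"
proof -
  obtain B where B: "B \<subseteq> insert a S" "indep B" "card B = matroid_rank indep (insert a S)"
    using matroid_rank_attained[of "insert a S" indep] assms by auto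
  have "indep (B - {a})" using assms(3)[OF B(2)] by blast
  then have "card (B - {a}) \<le> matroid_rank indep S"
    using card_le_matroid_rank[of S "B - {a}" indep] B(1) assms(1) by blast
  moreover have "card B \<le> Suc (card (B - {a}))" by (metis card.infinite card_Suc_Diff1 card_Diff_singleton_if le_SucI le_refl zero_le)
  ultimately show ?thesis using B(3) by simp
qed

lemma matroid_rank_Un_le:
  assumes "finite T" "finite S" "indep {}" "\<And>A B. indep A \<Longrightarrow> B \<subseteq> A \<Longrightarrow> indep B"
  shows "matroid_rank indep (S \<union> T) \<le> matroid_rank indep S + card T"
  using assms(1)
proof (induction T)
  case (insert a T)
  have "matroid_rank indep (insert a (S \<union> T)) \<le> Suc (matroid_rank indep (S \<union> T))"
    by (rule matroid_rank_insert_le) (use insert assms in auto)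
  then show ?case using insert by simp
qed simp

section \<open>Rank of the underlying matroid through covectors\<close>

abbreviation circuit_rank :: "'a set \<Rightarrow> 'a signed set \<Rightarrow> 'a set \<Rightarrow> nat" where
  "circuit_rank E \<C> \<equiv> matroid_rank (underlying_indep E \<C>)"

lemma underlying_indep_empty: "oriented_matroid E \<C> \<Longrightarrow> underlying_indep E \<C> {}"
  by (auto simp: underlying_indep_def oriented_matroid_def supp_def)

lemma underlying_indep_subset: "underlying_indep E \<C> A \<Longrightarrow> B \<subseteq> A \<Longrightarrow> underlying_indep E \<C> B"
  unfolding underlying_indep_def by blast

text \<open>Basis exchange by covectors in place of the augmentation axiom. Painting gives a
  covector that meets the independent set \<open>I\<close> only in \<open>g\<close>; the circuit
  \<open>X\<close> meets it in a second element \<open>h\<close>, and \<open>h\<close> can replace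
  \<open>g\<close>, because a circuit in the new set would meet the covector in \<open>h\<close>
  alone.\<close>

lemma circuit_rank_insert_spanned:
  assumes om: "oriented_matroid E \<C>" and S: "S \<subseteq> E" and X: "X \<in> \<C>" "g \<in> supp X" "supp X \<subseteq> insert g S"
  shows "circuit_rank E \<C> (insert g S) = circuit_rank E \<C> S"
proof (rule antisym)
  have finE: "finite E" using om by (simp add: oriented_matroid_def)
  have finS: "finite S" using S finE finite_subset by blast
  have XE: "supp X \<subseteq> E" using om_signed[OF om X(1)] by (auto simp: supp_def)
  obtain I where I: "I \<subseteq> insert g S" "underlying_indep E \<C> I" "card I = circuit_rank E \<C> (insert g S)"
    using matroid_rank_attained[of "insert g S" "underlying_indep E \<C>"] finS underlying_indep_empty[OF om]
    by auto
  show "circuit_rank E \<C> (insert g S) \<le> circuit_rank E \<C> S"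
  proof (cases "g \<in> I")
    case False
    then show ?thesis using card_le_matroid_rank[OF finS, of I] I by auto
  next
    case True
    have IE: "I \<subseteq> E" using I(2) by (simp add: underlying_indep_def)
    have "(\<exists>X \<in> \<C>. g \<in> fst X \<and> fst X \<subseteq> {g} \<union> (I - {g}) \<and> snd X \<subseteq> {} \<union> (I - {g})) \<or>
      (\<exists>U \<in> covectors E \<C>. g \<in> fst U \<and> fst U \<inter> ({} \<union> (I - {g})) = {} \<and> snd U \<inter> ({g} \<union> (I - {g})) = {})"
      by (rule painting[OF om]) (use IE True in auto)
    moreover have "\<not> (\<exists>X \<in> \<C>. g \<in> fst X \<and> fst X \<subseteq> {g} \<union> (I - {g}) \<and> snd X \<subseteq> {} \<union> (I - {g}))"
      using I(2) True by (auto simp: underlying_indep_def supp_def)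
    ultimately obtain U where "U \<in> covectors E \<C>" "g \<in> fst U" "fst U \<inter> (I - {g}) = {}"
      "snd U \<inter> ({g} \<union> (I - {g})) = {}" by auto
    then have U: "U \<in> covectors E \<C>" "g \<in> supp U" "supp U \<inter> I \<subseteq> {g}"
      by (auto simp: supp_def)
    obtain h where h: "h \<noteq> g" "h \<in> supp X" "h \<in> supp U"
      using circuit_covector_other[OF om X(1) U(1) X(2) U(2)] by blast
    have hI: "h \<notin> I" using h U(3) by blast
    have "underlying_indep E \<C> (insert h (I - {g}))"
      unfolding underlying_indep_def
    proof (intro conjI ballI notI)
      show "insert h (I - {g}) \<subseteq> E" using IE h XE by blast
      fix X' assume X': "X' \<in> \<C>" "supp X' \<subseteq> insert h (I - {g})"
      have "h \<in> supp X'" using X' I(2) by (auto simp: underlying_indep_def)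
      then show False using circuit_covector_other[OF om X'(1) U(1), of h] h X'(2) U(3) by blast
    qed
    then have "card (insert h (I - {g})) \<le> circuit_rank E \<C> S"
      using card_le_matroid_rank[OF finS, of "insert h (I - {g})"] I(1) h X(3) by auto
    moreover have "finite I" using I(1) finS finite_subset by blast
    then have "card (insert h (I - {g})) = card I" using hI True
      by (metis card_Suc_Diff1 card_insert_disjoint finite_Diff insert_Diff insert_iff)
    ultimately show ?thesis using I(3) by simp
  qed
  show "circuit_rank E \<C> S \<le> circuit_rank E \<C> (insert g S)"
    by (rule matroid_rank_mono) (use finS underlying_indep_empty[OF om] in auto)
qed

text \<open>Painting \<open>g\<close> positive and \<open>S\<close> free separates the cases: a
  covector exhibits \<open>g\<close> as a coloop of the restriction to \<open>insert g S\<close>, a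
  circuit shows that \<open>S\<close> spans \<open>g\<close>.\<close>

lemma coloop_or_spanned:
  assumes om: "oriented_matroid E \<C>" and S: "insert g S \<subseteq> E" "g \<notin> S"
  shows "(\<exists>Y \<in> covectors E \<C>. g \<in> fst Y \<and> supp Y \<inter> insert g S = {g}) \<or>
    circuit_rank E \<C> (insert g S) = circuit_rank E \<C> S"
proof -
  have "(\<exists>X \<in> \<C>. g \<in> fst X \<and> fst X \<subseteq> {g} \<union> S \<and> snd X \<subseteq> {} \<union> S) \<or>
    (\<exists>U \<in> covectors E \<C>. g \<in> fst U \<and> fst U \<inter> ({} \<union> S) = {} \<and> snd U \<inter> ({g} \<union> S) = {})"
    by (rule painting[OF om]) (use S in auto)
  then show ?thesis
  proof
    assume "\<exists>X \<in> \<C>. g \<in> fst X \<and> fst X \<subseteq> {g} \<union> S \<and> snd X \<subseteq> {} \<union> S"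
    then obtain X where "X \<in> \<C>" "g \<in> supp X" "supp X \<subseteq> insert g S" by (auto simp: supp_def)
    then show ?thesis using circuit_rank_insert_spanned[OF om] S by blast
  next
    assume "\<exists>U \<in> covectors E \<C>. g \<in> fst U \<and> fst U \<inter> ({} \<union> S) = {} \<and> snd U \<inter> ({g} \<union> S) = {}"
    then obtain U where U: "U \<in> covectors E \<C>" "g \<in> fst U" "fst U \<inter> S = {}" "snd U \<inter> insert g S = {}"
      by auto
    then have "supp U \<inter> insert g S = {g}" by (auto simp: supp_def)
    then show ?thesis using U by blast
  qed
qed

text \<open>Deleting the elements outside \<open>Z \<union> A \<union> B\<close> and contracting \<open>Z\<close> gives an oriented matroid
  minor on \<open>A \<union> B\<close>; the faces are those of its nonnegative cone, and only the facets in \<open>B\<close> are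
  kept as vertices.\<close>

definition face_complex :: "'a set \<Rightarrow> 'a signed set \<Rightarrow> 'a set \<Rightarrow> 'a set \<Rightarrow> 'a set \<Rightarrow> 'a set set" where
  "face_complex E \<C> Z A B = {\<sigma>. \<sigma> \<subseteq> B \<and> (\<exists>Y \<in> covectors E \<C>.
     supp Y \<inter> (Z \<union> \<sigma>) = {} \<and> snd Y \<inter> (A \<union> B) = {} \<and> fst Y \<inter> (A \<union> B) \<noteq> {})}"

lemma face_complexI:
  assumes "\<sigma> \<subseteq> B" "Y \<in> covectors E \<C>" "supp Y \<inter> (Z \<union> \<sigma>) = {}" "snd Y \<inter> (A \<union> B) = {}" "fst Y \<inter> (A \<union> B) \<noteq> {}"
  shows "\<sigma> \<in> face_complex E \<C> Z A B"
  using assms unfolding face_complex_def by blast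

lemma face_complexE:
  assumes "\<sigma> \<in> face_complex E \<C> Z A B"
  obtains Y where "\<sigma> \<subseteq> B" "Y \<in> covectors E \<C>" "supp Y \<inter> (Z \<union> \<sigma>) = {}" "snd Y \<inter> (A \<union> B) = {}"
    "fst Y \<inter> (A \<union> B) \<noteq> {}"
  using assms unfolding face_complex_def by blast

lemma face_complex_down: "\<sigma> \<in> face_complex E \<C> Z A B \<Longrightarrow> \<tau> \<subseteq> \<sigma> \<Longrightarrow> \<tau> \<in> face_complex E \<C> Z A B"
  by (elim face_complexE, rule face_complexI) blast+

text \<open>Mayer-Vietoris: dropping the sign constraint at \<open>g\<close> gives the union of the complexes with \<open>g\<close>
  nonnegative and with \<open>g\<close> nonpositive, which by covector elimination intersect in the link of \<open>g\<close>.\<close>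

lemma face_complex_acyclic_step:
  assumes om: "oriented_matroid E \<C>" and B: "B \<subseteq> E" and g: "g \<in> B" "g \<notin> A" "g \<notin> Z"
    and nocoloop: "\<not> (\<exists>Y \<in> covectors E \<C>. g \<in> fst Y \<and> supp Y \<inter> (Z \<union> A \<union> B) = {g})"
    and link: "\<And>j. k = Suc j \<Longrightarrow> acyclic_at E (face_complex E \<C> (insert g Z) A (B - {g})) j"
    and del: "acyclic_at E (face_complex E \<C> Z A (B - {g})) k"
  shows "acyclic_at E (face_complex E \<C> Z A B) k"
proof -
  let ?S = "A \<union> (B - {g})"
  define K0 where "K0 = face_complex E \<C> Z (insert g A) (B - {g})"
  \<comment> \<open>This is the complex with \<open>g\<close> nonpositive. It is written out because
    the sign conditions of \<open>face_complex\<close> all point the same way.\<close>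
  define K1 where "K1 = {\<sigma>. \<sigma> \<subseteq> B - {g} \<and> (\<exists>Y \<in> covectors E \<C>.
     supp Y \<inter> (Z \<union> \<sigma>) = {} \<and> snd Y \<inter> ?S = {} \<and> g \<notin> fst Y \<and> fst Y \<inter> ?S \<noteq> {})}"
  let ?L = "face_complex E \<C> (insert g Z) A (B - {g})"
  let ?Q = "face_complex E \<C> Z A (B - {g})"
  have S: "insert g A \<union> (B - {g}) = insert g ?S" "A \<union> B = insert g ?S" "g \<notin> ?S"
    using g by auto
  \<comment> \<open>A nonnegative covector that is positive only at \<open>g\<close> would exhibit
    \<open>g\<close> as a coloop. Nonvanishing can therefore be tested away from \<open>g\<close>,
    which makes the intersection and the union equal to the contraction and the deletion.\<close>
  have K0meets: "fst Y \<inter> ?S \<noteq> {}"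
    if "Y \<in> covectors E \<C>" "supp Y \<inter> Z = {}" "snd Y \<inter> insert g ?S = {}" "fst Y \<inter> insert g ?S \<noteq> {}" for Y
  proof
    assume no: "fst Y \<inter> ?S = {}"
    then have "g \<in> fst Y" using that(4) by blast
    moreover have "supp Y \<inter> (Z \<union> A \<union> B) = {g}"
      using that no \<open>g \<in> fst Y\<close> S(2) by (auto simp: supp_def)
    ultimately show False using nocoloop that(1) by blast
  qed
  have inter: "K0 \<inter> K1 = ?L"
  proof
    show "?L \<subseteq> K0 \<inter> K1"
    proof
      fix \<sigma> assume "\<sigma> \<in> ?L"
      then obtain Y where Y: "\<sigma> \<subseteq> B - {g}" "Y \<in> covectors E \<C>" "supp Y \<inter> (insert g Z \<union> \<sigma>) = {}"
        "snd Y \<inter> ?S = {}" "fst Y \<inter> ?S \<noteq> {}" by (rule face_complexE)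
      have "g \<notin> fst Y" "g \<notin> snd Y" using Y(3) by (auto simp: supp_def)
      then have "\<sigma> \<in> K0" unfolding K0_def
        by (intro face_complexI[OF Y(1,2)]) (use Y in auto)
      moreover have "\<sigma> \<in> K1" unfolding K1_def using Y \<open>g \<notin> fst Y\<close> by blast
      ultimately show "\<sigma> \<in> K0 \<inter> K1" by blast
    qed
    show "K0 \<inter> K1 \<subseteq> ?L"
    proof
      fix \<sigma> assume a: "\<sigma> \<in> K0 \<inter> K1"
      then obtain Y where Y: "\<sigma> \<subseteq> B - {g}" "Y \<in> covectors E \<C>" "supp Y \<inter> (Z \<union> \<sigma>) = {}"
        "snd Y \<inter> insert g ?S = {}" "fst Y \<inter> insert g ?S \<noteq> {}"
        unfolding K0_def using S(1) by (metis IntD1 face_complexE)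
      obtain W where W: "W \<in> covectors E \<C>" "supp W \<inter> (Z \<union> \<sigma>) = {}" "snd W \<inter> ?S = {}" "g \<notin> fst W"
        "fst W \<inter> ?S \<noteq> {}" using a unfolding K1_def by blast
      have meetY: "fst Y \<inter> ?S \<noteq> {}" using K0meets[of Y] Y by blast
      show "\<sigma> \<in> ?L"
      proof (cases "g \<in> fst Y")
        case False
        then have "g \<notin> supp Y" using Y(4) by (auto simp: supp_def)
        then show ?thesis using Y meetY by (intro face_complexI[OF Y(1,2)]) auto
      next
        case gY: True
        show ?thesis
        proof (cases "g \<in> snd W")
          case False
          then have "g \<notin> supp W" using W(4) by (auto simp: supp_def)
          then show ?thesis using Y(1) W by (intro face_complexI[OF _ W(1)]) auto
        next
          case True
          obtain s where s: "s \<in> fst Y" "s \<in> ?S" using meetY by blast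
          then have "s \<notin> snd W" using W(3) by blast
          then obtain U where U: "U \<in> covectors E \<C>" "s \<in> fst U" "fst U \<subseteq> (fst Y \<union> fst W) - {g}"
            "snd U \<subseteq> (snd Y \<union> snd W) - {g}"
            using covector_elimination[OF om Y(2) W(1), of g s] gY True s by blast
          have "supp U \<inter> (insert g Z \<union> \<sigma>) = {}"
            using U(3,4) Y(3) W(2) by (auto simp: supp_def)
          moreover have "snd U \<inter> ?S = {}" using U(4) Y(4) W(3) by blast
          ultimately show ?thesis using U(1,2) s by (intro face_complexI[OF Y(1) U(1)]) auto
        qed
      qed
    qed
  qed
  have union: "K0 \<union> K1 = ?Q"
  proof
    show "K0 \<union> K1 \<subseteq> ?Q"
    proof
      fix \<sigma> assume "\<sigma> \<in> K0 \<union> K1"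
      then show "\<sigma> \<in> ?Q"
      proof
        assume "\<sigma> \<in> K0"
        then obtain Y where Y: "\<sigma> \<subseteq> B - {g}" "Y \<in> covectors E \<C>" "supp Y \<inter> (Z \<union> \<sigma>) = {}"
          "snd Y \<inter> insert g ?S = {}" "fst Y \<inter> insert g ?S \<noteq> {}"
          unfolding K0_def using S(1) by (metis face_complexE)
        show ?thesis using Y K0meets[of Y] by (intro face_complexI[OF Y(1,2)]) auto
      next
        assume "\<sigma> \<in> K1"
        then show ?thesis unfolding K1_def face_complex_def by blast
      qed
    qed
    show "?Q \<subseteq> K0 \<union> K1"
    proof
      fix \<sigma> assume "\<sigma> \<in> ?Q"
      then obtain Y where Y: "\<sigma> \<subseteq> B - {g}" "Y \<in> covectors E \<C>" "supp Y \<inter> (Z \<union> \<sigma>) = {}"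
        "snd Y \<inter> ?S = {}" "fst Y \<inter> ?S \<noteq> {}" by (rule face_complexE)
      show "\<sigma> \<in> K0 \<union> K1"
      proof (cases "g \<in> snd Y")
        case True
        then have "g \<notin> fst Y" using covector_signed[OF Y(2)] by blast
        then show ?thesis using Y unfolding K1_def by blast
      next
        case False
        then have "\<sigma> \<in> K0" unfolding K0_def by (intro face_complexI[OF Y(1,2)]) (use Y in auto)
        then show ?thesis ..
      qed
    qed
  qed
  have whole: "face_complex E \<C> Z A B = K0 \<union> insert g ` (K0 \<inter> K1)"
  proof
    show "face_complex E \<C> Z A B \<subseteq> K0 \<union> insert g ` (K0 \<inter> K1)"
    proof
      fix \<sigma> assume "\<sigma> \<in> face_complex E \<C> Z A B"
      then obtain Y where Y: "\<sigma> \<subseteq> B" "Y \<in> covectors E \<C>" "supp Y \<inter> (Z \<union> \<sigma>) = {}"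
        "snd Y \<inter> insert g ?S = {}" "fst Y \<inter> insert g ?S \<noteq> {}" using S(2) by (metis face_complexE)
      show "\<sigma> \<in> K0 \<union> insert g ` (K0 \<inter> K1)"
      proof (cases "g \<in> \<sigma>")
        case False
        have "\<sigma> \<in> K0" unfolding K0_def
          by (rule face_complexI[OF _ Y(2,3)]) (use Y False S(1) in auto)
        then show ?thesis ..
      next
        case True
        have "\<sigma> - {g} \<in> ?L"
          by (rule face_complexI[OF _ Y(2)]) (use Y True in \<open>auto simp: supp_def\<close>)
        moreover have "\<sigma> = insert g (\<sigma> - {g})" using True by auto
        ultimately show ?thesis using inter by blast
      qed
    qed
    show "K0 \<union> insert g ` (K0 \<inter> K1) \<subseteq> face_complex E \<C> Z A B"
    proof
      fix \<sigma> assume "\<sigma> \<in> K0 \<union> insert g ` (K0 \<inter> K1)"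
      then show "\<sigma> \<in> face_complex E \<C> Z A B"
      proof
        assume "\<sigma> \<in> K0"
        then show ?thesis unfolding K0_def face_complex_def S(1) S(2) by blast
      next
        assume "\<sigma> \<in> insert g ` (K0 \<inter> K1)"
        then obtain \<tau> where t: "\<tau> \<in> ?L" "\<sigma> = insert g \<tau>" using inter by blast
        then obtain Y where Y: "\<tau> \<subseteq> B - {g}" "Y \<in> covectors E \<C>" "supp Y \<inter> (insert g Z \<union> \<tau>) = {}"
          "snd Y \<inter> ?S = {}" "fst Y \<inter> ?S \<noteq> {}" by (metis face_complexE)
        show ?thesis
          by (rule face_complexI[OF _ Y(2)]) (use Y t g in \<open>auto simp: supp_def\<close>)
      qed
    qed
  qed
  have finE: "finite E" using om by (simp add: oriented_matroid_def)
  have gE: "g \<in> E" using g B by blast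
  show ?thesis
    unfolding whole
  proof (rule acyclic_at_glue[OF finE gE])
    fix \<sigma> \<tau>
    show "\<sigma> \<in> K0 \<Longrightarrow> \<sigma> \<subseteq> E - {g}" using B unfolding K0_def face_complex_def by blast
    show "\<sigma> \<in> K0 \<Longrightarrow> \<tau> \<subseteq> \<sigma> \<Longrightarrow> \<tau> \<in> K0" unfolding K0_def by (rule face_complex_down)
    show "\<sigma> \<in> K1 \<Longrightarrow> \<sigma> \<subseteq> E - {g}" using B unfolding K1_def by blast
    show "\<sigma> \<in> K1 \<Longrightarrow> \<tau> \<subseteq> \<sigma> \<Longrightarrow> \<tau> \<in> K1" unfolding K1_def by blast
  qed (use link del inter union in simp_all)
qed

text \<open>When \<open>B\<close> consists of coloops, every proper subset of \<open>B\<close> is a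
  face: the covector of a missing element vanishes on the rest. So the complex is the full simplex
  on \<open>B\<close> or its boundary, and the rank bound keeps \<open>k\<close> below the top
  degree in the second case.\<close>

lemma face_complex_acyclic_base:
  assumes om: "oriented_matroid E \<C>" and sub: "Z \<subseteq> E" "A \<subseteq> E" "B \<subseteq> E"
    and disj: "Z \<inter> A = {}" "Z \<inter> B = {}" "A \<inter> B = {}"
    and coloops: "\<And>g. g \<in> B \<Longrightarrow> \<exists>Y \<in> covectors E \<C>. g \<in> fst Y \<and> supp Y \<inter> (Z \<union> A \<union> B) = {g}"
    and k: "k + 1 + max (card A) 1 + circuit_rank E \<C> Z \<le> circuit_rank E \<C> (Z \<union> A \<union> B)"
  shows "acyclic_at E (face_complex E \<C> Z A B) k"
proof -
  let ?K = "face_complex E \<C> Z A B"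
  have finE: "finite E" using om by (simp add: oriented_matroid_def)
  have fins: "finite Z" "finite A" "finite B" using sub finE finite_subset by blast+
  have rk: "circuit_rank E \<C> (S \<union> T) \<le> circuit_rank E \<C> S + card T" if "finite S" "finite T" for S T
    by (rule matroid_rank_Un_le)
      (use that underlying_indep_empty[OF om] underlying_indep_subset in auto)
  have rkZ: "circuit_rank E \<C> (Z \<union> A \<union> B) \<le> circuit_rank E \<C> Z + card A + card B"
    using rk[of "Z \<union> A" B] rk[of Z A] fins by simp
  then have Bne: "B \<noteq> {}" using k by (auto simp: max_def split: if_splits)
  then obtain b where b: "b \<in> B" by blast
  have proper: "\<sigma> \<in> ?K" if s: "\<sigma> \<subset> B" for \<sigma>
  proof -
    obtain h where h: "h \<in> B" "h \<notin> \<sigma>" using s by blast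
    then obtain Y where Y: "Y \<in> covectors E \<C>" "h \<in> fst Y" "supp Y \<inter> (Z \<union> A \<union> B) = {h}"
      using coloops by blast
    have "h \<notin> snd Y" using Y(2) covector_signed[OF Y(1)] by blast
    moreover have "h \<notin> Z" using h disj by blast
    ultimately show ?thesis
      using Y h s by (intro face_complexI[OF _ Y(1)]) (auto simp: supp_def)
  qed
  have finK: "finite \<sigma>" if "\<sigma> \<in> ?K" for \<sigma>
    using that fins(3) finite_subset unfolding face_complex_def by blast
  \<comment> \<open>The origin of \<open>max (card A) 1\<close>. If \<open>A\<close> is empty,
    \<open>B\<close> is never a face, and excluding the top class of the boundary of the simplex
    costs one unit. If \<open>A\<close> is nonempty and \<open>k\<close> reaches that degree, the
    rank count makes an element of \<open>A\<close> a coloop, whose covector vanishes on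
    \<open>B\<close>.\<close>
  have key: "B \<in> ?K \<or> Suc k < card B"
  proof (cases "A = {}")
    case True
    then show ?thesis using k rkZ by simp
  next
    case False
    show ?thesis
    proof (rule ccontr)
      assume no: "\<not> ?thesis"
      obtain a where a: "a \<in> A" using False by blast
      let ?S = "Z \<union> (A - {a}) \<union> B"
      have ins: "insert a ?S = Z \<union> A \<union> B" using a by auto
      have "card A \<ge> 1" using a fins(2) by (metis One_nat_def Suc_leI card_gt_0_iff empty_iff)
      moreover have "circuit_rank E \<C> ?S \<le> circuit_rank E \<C> Z + (card A - 1) + card B"
        using rk[of "Z \<union> (A - {a})" B] rk[of Z "A - {a}"] fins a by simp
      ultimately have "circuit_rank E \<C> (insert a ?S) \<noteq> circuit_rank E \<C> ?S"
        unfolding ins using k no by (auto simp: max_def)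
      moreover have "insert a ?S \<subseteq> E" "a \<notin> ?S" using sub a disj by blast+
      ultimately obtain Y where Y: "Y \<in> covectors E \<C>" "a \<in> fst Y" "supp Y \<inter> insert a ?S = {a}"
        using coloop_or_spanned[OF om, of a ?S] by blast
      have aY: "a \<notin> snd Y" using Y(2) covector_signed[OF Y(1)] by blast
      have "supp Y \<inter> (Z \<union> A \<union> B) = {a}" using Y(3) ins by simp
      then have "B \<in> ?K"
        using Y(2) a aY disj by (intro face_complexI[OF _ Y(1)]) (auto simp: supp_def)
      then show False using no by blast
    qed
  qed
  show ?thesis
  proof (rule acyclic_at_cone[OF finE _ finK, of b])
    show "b \<in> E" using b sub by blast
    fix \<sigma> assume s: "\<sigma> \<in> ?K" "card \<sigma> = k" "b \<notin> \<sigma>"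
    have "\<sigma> \<subseteq> B" using s(1) unfolding face_complex_def by blast
    then have sub': "insert b \<sigma> \<subseteq> B" using b by blast
    show "insert b \<sigma> \<in> ?K"
    proof (cases "insert b \<sigma> = B")
      case False then show ?thesis using proper sub' by blast
    next
      case True
      then have "card B = Suc k" using s finK[OF s(1)] by (metis card_insert_disjoint)
      then show ?thesis using key True by simp
    qed
  qed simp
qed

text \<open>Removing an element \<open>g\<close> that is not a coloop preserves the bound: deletion
  leaves the total rank unchanged, and contraction raises the rank of \<open>Z\<close> by at most
  one while the degree drops by one. The set \<open>A\<close> stays fixed, and the induction stops
  when only coloops are left in \<open>B\<close>.\<close>

theorem face_complex_acyclic:
  assumes om: "oriented_matroid E \<C>"
  shows "Z \<subseteq> E \<Longrightarrow> A \<subseteq> E \<Longrightarrow> B \<subseteq> E \<Longrightarrow> Z \<inter> A = {} \<Longrightarrow> Z \<inter> B = {} \<Longrightarrow> A \<inter> B = {} \<Longrightarrow>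
    k + 1 + max (card A) 1 + circuit_rank E \<C> Z \<le> circuit_rank E \<C> (Z \<union> A \<union> B) \<Longrightarrow>
    acyclic_at E (face_complex E \<C> Z A B) k"
proof (induction "card B" arbitrary: Z B k rule: less_induct)
  case less
  have finE: "finite E" using om by (simp add: oriented_matroid_def)
  have fins: "finite Z" "finite B" using less.prems finE finite_subset by blast+
  show ?case
  proof (cases "\<forall>g \<in> B. \<exists>Y \<in> covectors E \<C>. g \<in> fst Y \<and> supp Y \<inter> (Z \<union> A \<union> B) = {g}")
    case True
    then show ?thesis using face_complex_acyclic_base[OF om less.prems(1-6) _ less.prems(7)] by blast
  next
    case False
    then obtain g where g: "g \<in> B"
      and nc: "\<not> (\<exists>Y \<in> covectors E \<C>. g \<in> fst Y \<and> supp Y \<inter> (Z \<union> A \<union> B) = {g})" by blast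
    have gn: "g \<notin> A" "g \<notin> Z" using g less.prems by blast+
    let ?S = "Z \<union> A \<union> (B - {g})"
    have ins: "insert g ?S = Z \<union> A \<union> B" using g by auto
    have "insert g ?S \<subseteq> E" "g \<notin> ?S" using less.prems g gn by blast+
    then have rkeq: "circuit_rank E \<C> (Z \<union> A \<union> B) = circuit_rank E \<C> ?S"
      using coloop_or_spanned[OF om, of g ?S] nc unfolding ins by blast
    have rkZ: "circuit_rank E \<C> (insert g Z) \<le> Suc (circuit_rank E \<C> Z)"
      by (rule matroid_rank_insert_le)
        (use fins underlying_indep_empty[OF om] underlying_indep_subset in auto)
    have smaller: "card (B - {g}) < card B" using card_Diff1_less[OF fins(2) g] .
    show ?thesis
    proof (rule face_complex_acyclic_step[OF om less.prems(3) g gn nc])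
      fix j assume "k = Suc j"
      moreover have "insert g Z \<union> A \<union> (B - {g}) = Z \<union> A \<union> B" using g by auto
      ultimately have "j + 1 + max (card A) 1 + circuit_rank E \<C> (insert g Z)
          \<le> circuit_rank E \<C> (insert g Z \<union> A \<union> (B - {g}))"
        using less.prems(7) rkZ by simp
      then show "acyclic_at E (face_complex E \<C> (insert g Z) A (B - {g})) j"
        by (intro less.hyps[OF smaller]) (use less.prems g gn in auto)
    next
      show "acyclic_at E (face_complex E \<C> Z A (B - {g})) k"
        by (intro less.hyps[OF smaller]) (use less.prems g gn rkeq in auto)
    qed
  qed
qed

section \<open>Flats and double circuits\<close>

lemma matroid_empty: "matroid E indep \<Longrightarrow> indep {}"
  and matroid_finite: "matroid E indep \<Longrightarrow> finite E"
  by (simp_all add: matroid_def)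

lemma matroid_indep_subset: "matroid E indep \<Longrightarrow> indep A \<Longrightarrow> B \<subseteq> A \<Longrightarrow> indep B"
  by (simp add: matroid_def)

lemma matroid_augment:
  "matroid E indep \<Longrightarrow> indep A \<Longrightarrow> indep B \<Longrightarrow> card A < card B \<Longrightarrow> \<exists>b \<in> B - A. indep (insert b A)"
  by (simp add: matroid_def)

lemma matroid_basis_extend:
  assumes M: "matroid E indep" and S: "S \<subseteq> E"
  shows "indep I \<Longrightarrow> I \<subseteq> S \<Longrightarrow> \<exists>J. I \<subseteq> J \<and> J \<subseteq> S \<and> indep J \<and> card J = matroid_rank indep S"
proof (induction "matroid_rank indep S - card I" arbitrary: I)
  case 0
  have "finite S" using S matroid_finite[OF M] finite_subset by blast
  then show ?case using 0 card_le_matroid_rank[of S I indep] by (intro exI[of _ I]) auto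
next
  case (Suc n)
  have finS: "finite S" using S matroid_finite[OF M] finite_subset by blast
  obtain B where B: "B \<subseteq> S" "indep B" "card B = matroid_rank indep S"
    using matroid_rank_attained[where indep = indep, OF finS matroid_empty[OF M]] .
  have "card I < card B" using Suc(2) B(3) by simp
  then obtain b where b: "b \<in> B - I" "indep (insert b I)"
    using matroid_augment[OF M Suc.prems(1) B(2)] by blast
  have "finite I" using Suc.prems finS finite_subset by blast
  then have "n = matroid_rank indep S - card (insert b I)" using Suc(2) b by auto
  then have "\<exists>J. insert b I \<subseteq> J \<and> J \<subseteq> S \<and> indep J \<and> card J = matroid_rank indep S"
    by (rule Suc(1)) (use b B Suc.prems in auto)
  then show ?case by blast
qed

definition closure :: "'a set \<Rightarrow> ('a set \<Rightarrow> bool) \<Rightarrow> 'a set \<Rightarrow> 'a set" where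
  "closure E indep A = {e \<in> E. matroid_rank indep (insert e A) = matroid_rank indep A}"

lemma closure_subset: "closure E indep A \<subseteq> E"
  by (auto simp: closure_def)

lemma closure_increasing: "A \<subseteq> E \<Longrightarrow> A \<subseteq> closure E indep A"
  by (auto simp: closure_def insert_absorb)

lemma rank_closure:
  assumes M: "matroid E indep" and A: "A \<subseteq> E"
  shows "matroid_rank indep (closure E indep A) = matroid_rank indep A"
proof (rule antisym)
  let ?C = "closure E indep A"
  have finE: "finite E" by (rule matroid_finite[OF M])
  have finA: "finite A" "finite ?C" using A closure_subset finE finite_subset by metis+
  obtain I where I: "I \<subseteq> A" "indep I" "card I = matroid_rank indep A"
    using matroid_rank_attained[where indep = indep, OF finA(1) matroid_empty[OF M]] .
  obtain J where J: "J \<subseteq> ?C" "indep J" "card J = matroid_rank indep ?C"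
    using matroid_rank_attained[where indep = indep, OF finA(2) matroid_empty[OF M]] .
  show "matroid_rank indep ?C \<le> matroid_rank indep A"
  proof (rule ccontr)
    assume "\<not> ?thesis"
    then obtain b where b: "b \<in> J - I" "indep (insert b I)"
      using matroid_augment[OF M I(2) J(2)] I(3) J(3) by auto
    have "card (insert b I) \<le> matroid_rank indep (insert b A)"
      by (rule card_le_matroid_rank) (use b I finA in auto)
    moreover have "matroid_rank indep (insert b A) = matroid_rank indep A"
      using b J(1) by (auto simp: closure_def)
    moreover have "finite I" by (rule finite_subset[OF I(1) finA(1)])
    ultimately show False using b I(3) by simp
  qed
  show "matroid_rank indep A \<le> matroid_rank indep ?C"
    by (rule matroid_rank_mono) (use finA closure_increasing[OF A] matroid_empty[OF M] in auto)
qed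

lemma closure_mono:
  assumes M: "matroid E indep" and AB: "A \<subseteq> B" and B: "B \<subseteq> E"
  shows "closure E indep A \<subseteq> closure E indep B"
proof
  fix e assume e: "e \<in> closure E indep A"
  have finE: "finite E" by (rule matroid_finite[OF M])
  have fin: "finite A" "finite B" using finite_subset[OF B finE] finite_subset[OF AB] by auto
  have eE: "e \<in> E" using e by (simp add: closure_def)
  obtain I where I: "I \<subseteq> A" "indep I" "card I = matroid_rank indep A"
    using matroid_rank_attained[where indep = indep, OF fin(1) matroid_empty[OF M]] .
  obtain J where J: "I \<subseteq> J" "J \<subseteq> B" "indep J" "card J = matroid_rank indep B"
    using matroid_basis_extend[OF M B I(2)] I(1) AB by blast
  obtain L where L: "L \<subseteq> insert e B" "indep L" "card L = matroid_rank indep (insert e B)"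
    using matroid_rank_attained[of "insert e B" indep] fin matroid_empty[OF M] by auto
  have le: "matroid_rank indep B \<le> matroid_rank indep (insert e B)"
    by (rule matroid_rank_mono) (use fin matroid_empty[OF M] in auto)
  have "matroid_rank indep (insert e B) = matroid_rank indep B"
  proof (rule ccontr)
    assume "matroid_rank indep (insert e B) \<noteq> matroid_rank indep B"
    then obtain b where b: "b \<in> L - J" "indep (insert b J)"
      using matroid_augment[OF M J(3) L(2)] J(4) L(3) le by auto
    have finJ: "finite J" by (rule finite_subset[OF J(2) fin(2)])
    have "b \<notin> B"
    proof
      assume "b \<in> B"
      then have "card (insert b J) \<le> matroid_rank indep B"
        using card_le_matroid_rank[where indep = indep, OF fin(2), of "insert b J"] b J by auto
      then show False using b finJ J(4) by simp
    qed
    then have "b = e" using b L(1) by blast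
    then have "indep (insert e I)" using matroid_indep_subset[OF M b(2)] J(1) by blast
    then have "card (insert e I) \<le> matroid_rank indep (insert e A)"
      using card_le_matroid_rank[of "insert e A" "insert e I" indep] I(1) fin by auto
    moreover have "e \<notin> I" using b \<open>b = e\<close> J(1) by blast
    moreover have "finite I" by (rule finite_subset[OF I(1) fin(1)])
    ultimately show False using e I(3) by (simp add: closure_def)
  qed
  then show "e \<in> closure E indep B" using eE by (simp add: closure_def)
qed

lemma closure_psubset_rank_less:
  assumes M: "matroid E indep" and S: "S \<subseteq> E" and T: "T \<subseteq> E"
    and less: "closure E indep S \<subset> closure E indep T"
  shows "matroid_rank indep (closure E indep S) < matroid_rank indep (closure E indep T)"
proof -
  let ?F = "closure E indep S" and ?G = "closure E indep T"
  have finE: "finite E" by (rule matroid_finite[OF M])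
  have fin: "finite ?F" "finite ?G" "finite S"
    using S closure_subset finE finite_subset by metis+
  obtain x where x: "x \<in> ?G" "x \<notin> ?F" using less by blast
  have xE: "x \<in> E" using x(1) by (simp add: closure_def)
  have "matroid_rank indep S \<le> matroid_rank indep (insert x S)"
    by (rule matroid_rank_mono) (use fin matroid_empty[OF M] in auto)
  moreover have "matroid_rank indep (insert x S) \<noteq> matroid_rank indep S"
    using x(2) xE by (simp add: closure_def)
  moreover have "matroid_rank indep (insert x S) \<le> matroid_rank indep ?G"
    by (rule matroid_rank_mono) (use fin matroid_empty[OF M] x less closure_increasing[OF S, of indep] in auto)
  ultimately show ?thesis using rank_closure[OF M S] by simp
qed

text \<open>An inclusion-minimal set of nullity at least two is a double circuit: by minimality
  every \<open>W - {e}\<close> has rank at least \<open>card W - 2\<close>, while \<open>W\<close>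
  itself has rank at most that, so monotonicity of the rank gives equality throughout.\<close>

lemma double_circuit_exists:
  assumes M: "matroid E indep"
  shows "W \<subseteq> E \<Longrightarrow> matroid_rank indep W + 2 \<le> card W \<Longrightarrow> \<exists>D \<subseteq> W. double_circuit E indep D"
proof (induction "card W" arbitrary: W rule: less_induct)
  case less
  have finW: "finite W" using less.prems matroid_finite[OF M] finite_subset by blast
  show ?case
  proof (cases "\<exists>e \<in> W. matroid_rank indep (W - {e}) + 2 \<le> card (W - {e})")
    case True
    then obtain e where e: "e \<in> W" "matroid_rank indep (W - {e}) + 2 \<le> card (W - {e})" by blast
    then have "\<exists>D \<subseteq> W - {e}. double_circuit E indep D"
      using less.hyps[of "W - {e}"] card_Diff1_less[OF finW e(1)] less.prems by blast
    then show ?thesis by blast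
  next
    case False
    have eq: "matroid_rank indep (W - {e}) + 2 = card W \<and> matroid_rank indep W + 2 = card W"
      if e: "e \<in> W" for e
    proof -
      have "matroid_rank indep (W - {e}) \<le> matroid_rank indep W"
        by (rule matroid_rank_mono) (use finW matroid_empty[OF M] in auto)
      moreover have "card (W - {e}) < matroid_rank indep (W - {e}) + 2" using False e by auto
      moreover have "card W = Suc (card (W - {e}))" by (rule card_Suc_Diff1[OF finW e, symmetric])
      ultimately show ?thesis using less.prems(2) by simp
    qed
    moreover have "W \<noteq> {}" using less.prems(2) by auto
    ultimately have "double_circuit E indep W"
      using less.prems(1) unfolding double_circuit_def by blast
    then show ?thesis by blast
  qed
qed

lemma Inter_chain_mem:
  assumes "finite c" "c \<noteq> {}" "\<forall>F\<in>c. \<forall>G\<in>c. F \<subseteq> G \<or> G \<subseteq> F"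
  shows "\<Inter>c \<in> c"
  using assms
proof (induction c rule: finite_ne_induct)
  case (insert F c)
  then have "\<Inter>c \<in> c" by blast
  then have "F \<subseteq> \<Inter>c \<or> \<Inter>c \<subseteq> F" using insert.prems by blast
  then have "F \<inter> \<Inter>c = F \<or> F \<inter> \<Inter>c = \<Inter>c" by blast
  then show ?case using \<open>\<Inter>c \<in> c\<close> by auto
qed simp

text \<open>Dropping the vertices in \<open>A\<close> does not relax the sign conditions on
  \<open>A\<close>. This is why \<open>face_complex\<close> keeps \<open>A\<close> apart from the
  vertex set \<open>B\<close>.\<close>

lemma face_complex_avoiding:
  assumes A: "A \<subseteq> E"
  shows "{\<sigma> \<in> face_complex E \<C> {} {} E. \<sigma> \<inter> A = {}} = face_complex E \<C> {} A (E - A)"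
proof (intro set_eqI iffI)
  have AE: "A \<union> (E - A) = E" using A by blast
  fix \<sigma>
  {
    assume "\<sigma> \<in> {\<sigma> \<in> face_complex E \<C> {} {} E. \<sigma> \<inter> A = {}}"
    then have s: "\<sigma> \<in> face_complex E \<C> {} {} E" "\<sigma> \<inter> A = {}" by simp_all
    from s(1) obtain Y where Y: "\<sigma> \<subseteq> E" "Y \<in> covectors E \<C>" "supp Y \<inter> ({} \<union> \<sigma>) = {}"
      "snd Y \<inter> ({} \<union> E) = {}" "fst Y \<inter> ({} \<union> E) \<noteq> {}" by (rule face_complexE)
    show "\<sigma> \<in> face_complex E \<C> {} A (E - A)"
      by (rule face_complexI[OF _ Y(2,3)]) (use Y s(2) AE in auto)
  next
    assume s: "\<sigma> \<in> face_complex E \<C> {} A (E - A)"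
    from s obtain Y where Y: "\<sigma> \<subseteq> E - A" "Y \<in> covectors E \<C>" "supp Y \<inter> ({} \<union> \<sigma>) = {}"
      "snd Y \<inter> (A \<union> (E - A)) = {}" "fst Y \<inter> (A \<union> (E - A)) \<noteq> {}" by (rule face_complexE)
    have "\<sigma> \<in> face_complex E \<C> {} {} E"
      by (rule face_complexI[OF _ Y(2,3)]) (use Y AE in auto)
    then show "\<sigma> \<in> {\<sigma> \<in> face_complex E \<C> {} {} E. \<sigma> \<inter> A = {}}" using Y(1) by blast
  }
qed

section \<open>Existence of a spanning face\<close>

context
  fixes E :: "'a set" and indep :: "'a set \<Rightarrow> bool" and \<C> :: "'a signed set"
  assumes M: "matroid E indep" and om: "oriented_matroid E \<C>"
    and rank: "circuit_rank E \<C> E = matroid_rank indep E + 1"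
    and double: "\<And>D. double_circuit E indep D \<Longrightarrow> \<exists>Y. positive_cocircuit E \<C> Y \<and> supp Y \<subseteq> D"
begin

lemma nullity_two_contains_positive_cocircuit:
  assumes "A \<subseteq> E" "matroid_rank indep A + 2 \<le> card A"
  shows "\<exists>Y \<in> covectors E \<C>. snd Y = {} \<and> fst Y \<noteq> {} \<and> fst Y \<subseteq> A"
proof -
  obtain D where D: "D \<subseteq> A" "double_circuit E indep D"
    using double_circuit_exists[OF M assms] by blast
  then obtain Y where "positive_cocircuit E \<C> Y" "supp Y \<subseteq> D" using double by blast
  then show ?thesis using D unfolding positive_cocircuit_def cocircuits_def supp_def by force
qed

text \<open>For nullity at most one, \<open>max (card A) 1\<close> is at most
  \<open>matroid_rank indep A + 1\<close>, and the added 1 is absorbed by \<open>rank\<close>. For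
  larger nullity a nonnegative covector supported inside \<open>A\<close> vanishes on all of
  \<open>E - A\<close>, so no face is missing.\<close>

lemma face_complex_restrict_acyclic:
  assumes A: "A \<subseteq> E" and k: "k + 1 + matroid_rank indep A \<le> matroid_rank indep E"
  shows "acyclic_at E (face_complex E \<C> {} A (E - A)) k"
proof (cases "card A \<le> matroid_rank indep A + 1")
  case True
  have AE: "A \<union> (E - A) = E" using A by blast
  have "circuit_rank E \<C> {} = 0"
    using matroid_rank_le_card[of "{}" "underlying_indep E \<C>"] underlying_indep_empty[OF om] by simp
  then show ?thesis
    by (intro face_complex_acyclic[OF om]) (use A True k rank AE in auto)
next
  case False
  then obtain Y where Y: "Y \<in> covectors E \<C>" "snd Y = {}" "fst Y \<noteq> {}" "fst Y \<subseteq> A"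
    using nullity_two_contains_positive_cocircuit[OF A] by auto
  \<comment> \<open>The bound on \<open>k\<close> rules out \<open>A = E\<close>, so the full
    simplex has a vertex to serve as apex.\<close>
  have "A \<noteq> E" using k by auto
  then obtain b where b: "b \<in> E" "b \<notin> A" using A by blast
  have full: "\<sigma> \<in> face_complex E \<C> {} A (E - A)" if "\<sigma> \<subseteq> E - A" for \<sigma>
    by (rule face_complexI[OF that Y(1)]) (use Y that in \<open>auto simp: supp_def\<close>)
  have finE: "finite E" by (rule matroid_finite[OF M])
  have sub: "\<sigma> \<subseteq> E - A" if "\<sigma> \<in> face_complex E \<C> {} A (E - A)" for \<sigma>
    using that unfolding face_complex_def by blast
  show ?thesis
  proof (rule acyclic_at_cone[OF finE b(1)])
    fix \<sigma> assume "\<sigma> \<in> face_complex E \<C> {} A (E - A)"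
    then have s: "\<sigma> \<subseteq> E - A" by (rule sub)
    then show "finite \<sigma>" using finE finite_subset by blast
    show "insert b \<sigma> \<in> face_complex E \<C> {} A (E - A)" by (rule full) (use s b in blast)
  qed
qed

text \<open>Acyclicity does not give this, since a complex without any face satisfies
  \<open>acyclic_at\<close> trivially. Either \<open>E\<close> has nullity at least two and contains
  a positive cocircuit, or \<open>card E\<close> equals the rank of the oriented matroid and every
  element is a coloop.\<close>

lemma face_complex_nonempty: "{} \<in> face_complex E \<C> {} {} E"
proof -
  have finE: "finite E" by (rule matroid_finite[OF M])
  have "circuit_rank E \<C> E \<le> card E"
    by (rule matroid_rank_le_card) (use finE underlying_indep_empty[OF om] in auto)
  then consider "matroid_rank indep E + 2 \<le> card E" | "card E = matroid_rank indep E + 1"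
    using rank by linarith
  then have "\<exists>Y \<in> covectors E \<C>. snd Y = {} \<and> fst Y \<noteq> {}"
  proof cases
    case 1
    then show ?thesis using nullity_two_contains_positive_cocircuit[of E] by blast
  next
    case 2
    then obtain g where g: "g \<in> E" by fastforce
    then have ins: "insert g (E - {g}) = E" by blast
    have "circuit_rank E \<C> (E - {g}) \<le> card (E - {g})"
      by (rule matroid_rank_le_card) (use finE underlying_indep_empty[OF om] in auto)
    also have "\<dots> < card E" using card_Diff1_less[OF finE g] .
    finally have "circuit_rank E \<C> (insert g (E - {g})) \<noteq> circuit_rank E \<C> (E - {g})"
      unfolding ins using 2 rank by simp
    then obtain Y where Y: "Y \<in> covectors E \<C>" "g \<in> fst Y" "supp Y \<inter> E = {g}"
      using coloop_or_spanned[OF om, of g "E - {g}"] unfolding ins by blast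
    then have "snd Y = {}" using covector_signed[OF Y(1)] unfolding supp_def by blast
    then show ?thesis using Y by blast
  qed
  then obtain Y where "Y \<in> covectors E \<C>" "snd Y = {}" "fst Y \<noteq> {}" by blast
  moreover from this have "fst Y \<subseteq> E" using covector_signed by blast
  ultimately show ?thesis by (intro face_complexI[of _ _ Y]) auto
qed

lemma spanning_face_exists:
  "\<exists>\<sigma> \<in> face_complex E \<C> {} {} E. matroid_rank indep \<sigma> = matroid_rank indep E"
proof (rule ccontr)
  assume no: "\<not> ?thesis"
  let ?m = "matroid_rank indep E" and ?K = "face_complex E \<C> {} {} E" and ?cl = "closure E indep"
  have finE: "finite E" by (rule matroid_finite[OF M])
  have KE: "\<sigma> \<subseteq> E" if "\<sigma> \<in> ?K" for \<sigma> using that unfolding face_complex_def by blast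
  have nonspanning: "matroid_rank indep \<sigma> < ?m" if "\<sigma> \<in> ?K" for \<sigma>
  proof -
    have "matroid_rank indep \<sigma> \<le> ?m"
      by (rule matroid_rank_mono) (use finE KE[OF that] matroid_empty[OF M] in simp_all)
    moreover have "matroid_rank indep \<sigma> \<noteq> ?m" using no that by blast
    ultimately show ?thesis by simp
  qed
  define W where "W = {?cl T | T. T \<subseteq> E \<and> matroid_rank indep (?cl T) < ?m}"
  define X where "X = {c. c \<subseteq> W \<and> (\<forall>F\<in>c. \<forall>G\<in>c. F \<subseteq> G \<or> G \<subseteq> F)}"
  \<comment> \<open>\<open>\<Inter>c\<close> is the smallest flat of the chain. Enlarging the chain
    can only lower it, and avoiding a smaller flat leaves more faces, so \<open>\<Gamma>\<close> is
    monotone.\<close>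
  define \<Gamma> where "\<Gamma> = (\<lambda>c. if c = {} then {{}} else {\<sigma> \<in> ?K. \<sigma> \<inter> \<Inter>c = {}})"
  \<comment> \<open>The condition \<open>T \<noteq> {}\<close> is essential: the flat
    \<open>?cl {}\<close> would otherwise be spanned by the empty subface of every face, and the
    chain consisting of it alone would be a harmless fixed chain. It also makes
    \<open>\<Delta> {}\<close> consist of the empty chain only.\<close>
  define \<Delta> where "\<Delta> = (\<lambda>\<sigma>. {d \<in> X. \<forall>F\<in>d. \<exists>T. T \<noteq> {} \<and> T \<subseteq> \<sigma> \<and> F = ?cl T})"
  have WD: "\<exists>T. T \<subseteq> E \<and> F = ?cl T" "matroid_rank indep F < ?m" if "F \<in> W" for F
    using that by (auto simp: W_def)
  have WE: "W \<subseteq> Pow E"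
  proof
    fix F assume "F \<in> W"
    then obtain T where "F = ?cl T" using WD(1) by blast
    then show "F \<in> Pow E" using closure_subset[of E indep T] by simp
  qed
  have XD: "c \<subseteq> W" "\<forall>F\<in>c. \<forall>G\<in>c. F \<subseteq> G \<or> G \<subseteq> F" if "c \<in> X" for c
    using that by (auto simp: X_def)
  have XI: "insert P c \<in> X" if "c \<in> X" "P \<in> W" "\<forall>F\<in>c. P \<subseteq> F \<or> F \<subseteq> P" for P c
    using XD[OF that(1)] that(2,3) by (simp add: X_def) metis
  have finW: "finite W" using WE finE by (meson finite_Pow_iff finite_subset)
  have finX: "finite c" if "c \<in> X" for c by (rule finite_subset[OF XD(1)[OF that] finW])
  have bottom: "\<Inter>c \<in> c" if "c \<in> X" "c \<noteq> {}" for c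
    by (rule Inter_chain_mem[OF finX[OF that(1)] that(2) XD(2)[OF that(1)]])
  have clW: "?cl \<sigma> \<in> W" if "\<sigma> \<in> ?K" for \<sigma>
  proof -
    have "matroid_rank indep (?cl \<sigma>) < ?m"
      using nonspanning[OF that] rank_closure[OF M KE[OF that]] by simp
    then show ?thesis unfolding W_def using KE[OF that] by blast
  qed
  have \<Gamma>acyc: "acyclic_at E (\<Gamma> c) k" if c: "c \<in> X" "card c = Suc k" for c k
  proof -
    have ne: "c \<noteq> {}" using c(2) by auto
    let ?F = "\<Inter>c"
    have Fc: "?F \<in> c" by (rule bottom[OF c(1) ne])
    have FE: "?F \<subseteq> E" using subsetD[OF WE subsetD[OF XD(1)[OF c(1)] Fc]] by (rule PowD)
    have less: "matroid_rank indep F < matroid_rank indep G" if FG: "F \<in> c" "G \<in> c" "F \<subset> G" for F G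
    proof -
      obtain S where S: "S \<subseteq> E" "F = ?cl S" using WD(1)[OF subsetD[OF XD(1)[OF c(1)] FG(1)]] by blast
      obtain T where T: "T \<subseteq> E" "G = ?cl T" using WD(1)[OF subsetD[OF XD(1)[OF c(1)] FG(2)]] by blast
      show ?thesis using closure_psubset_rank_less[OF M S(1) T(1)] FG(3) S(2) T(2) by simp
    qed
    have "inj_on (matroid_rank indep) c"
    proof (rule inj_onI)
      fix F G assume FG: "F \<in> c" "G \<in> c" "matroid_rank indep F = matroid_rank indep G"
      then have "F \<subseteq> G \<or> G \<subseteq> F" using XD(2)[OF c(1)] by blast
      then show "F = G" using less[of F G] less[of G F] FG by auto
    qed
    moreover have "matroid_rank indep ` c \<subseteq> {matroid_rank indep ?F..<?m}"
    proof
      fix i assume "i \<in> matroid_rank indep ` c"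
      then obtain G where G: "G \<in> c" "i = matroid_rank indep G" by blast
      have "matroid_rank indep ?F \<le> matroid_rank indep G"
      proof (cases "?F = G")
        case False
        then have "?F \<subset> G" using Inter_lower[OF G(1)] by simp
        then show ?thesis using less[OF Fc G(1)] by simp
      qed simp
      moreover have "matroid_rank indep G < ?m" using WD(2) XD(1)[OF c(1)] G(1) by blast
      ultimately show "i \<in> {matroid_rank indep ?F..<?m}" using G(2) by simp
    qed
    ultimately have "card c \<le> card {matroid_rank indep ?F..<?m}"
      by (metis card_image card_mono finite_atLeastLessThan)
    \<comment> \<open>The \<open>k + 1\<close> flats of the chain have distinct ranks from that of
      \<open>?F\<close> up to \<open>?m - 1\<close>, which is precisely the range of degrees
      available for \<open>?F\<close>.\<close>
    then have "k + 1 + matroid_rank indep ?F \<le> ?m" using c(2) by simp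
    then have "acyclic_at E (face_complex E \<C> {} ?F (E - ?F)) k"
      by (rule face_complex_restrict_acyclic[OF FE])
    moreover have "\<Gamma> c = face_complex E \<C> {} ?F (E - ?F)"
      unfolding \<Gamma>_def face_complex_avoiding[OF FE, symmetric] using ne by simp
    ultimately show ?thesis by simp
  qed
  have \<Delta>D: "d \<in> X" "F \<in> d \<Longrightarrow> \<exists>T. T \<noteq> {} \<and> T \<subseteq> \<sigma> \<and> F = ?cl T" if "d \<in> \<Delta> \<sigma>" for d \<sigma> F
    using that by (auto simp: \<Delta>_def)
  have \<Delta>acyc: "acyclic_at W (\<Delta> \<sigma>) k" if s: "\<sigma> \<in> ?K" "card \<sigma> = Suc k" for \<sigma> k
  proof (rule acyclic_at_cone[OF finW clW[OF s(1)]])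
    have ne: "\<sigma> \<noteq> {}" using s(2) by auto
    fix d assume d: "d \<in> \<Delta> \<sigma>"
    show "finite d" by (rule finX[OF \<Delta>D(1)[OF d]])
    have top: "F \<subseteq> ?cl \<sigma>" if "F \<in> d" for F
    proof -
      obtain T where T: "T \<subseteq> \<sigma>" "F = ?cl T" using \<Delta>D(2)[OF d \<open>F \<in> d\<close>] by blast
      then show ?thesis using closure_mono[OF M T(1) KE[OF s(1)]] by simp
    qed
    \<comment> \<open>All flats spanned by subfaces of \<open>\<sigma>\<close> lie below
      \<open>?cl \<sigma>\<close>, which is itself such a flat as \<open>\<sigma>\<close> is
      nonempty; so the order complex is a cone with this apex.\<close>
    have "insert (?cl \<sigma>) d \<in> X"
      by (rule XI[OF \<Delta>D(1)[OF d] clW[OF s(1)]]) (use top in simp)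
    then show "insert (?cl \<sigma>) d \<in> \<Delta> \<sigma>" using \<Delta>D(2)[OF d] ne by (auto simp: \<Delta>_def)
  qed
  have "\<exists>c\<in>X. c \<noteq> {} \<and> (\<exists>\<sigma>\<in>\<Gamma> c. c \<in> \<Delta> \<sigma>)"
  proof (rule carrier_fixed_point[where K = ?K and W = W and V = E and p = "?cl {}"])
    show "X \<subseteq> Pow W" "{} \<in> X" "\<And>c d. c \<in> X \<Longrightarrow> d \<subseteq> c \<Longrightarrow> d \<in> X"
      unfolding X_def by blast+
    show clW0: "?cl {} \<in> W" by (rule clW[OF face_complex_nonempty])
    show "insert (?cl {}) c \<in> X" if c: "c \<in> X" for c
    proof -
      have "?cl {} \<subseteq> F" if "F \<in> c" for F
      proof -
        obtain T where T: "T \<subseteq> E" "F = ?cl T" using WD(1)[OF subsetD[OF XD(1)[OF c] \<open>F \<in> c\<close>]] by blast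
        then show ?thesis using closure_mono[OF M empty_subsetI T(1)] by simp
      qed
      then show ?thesis by (intro XI[OF c clW0]) simp
    qed
    show "?K \<subseteq> Pow E" using KE by blast
    show "\<And>\<sigma> \<tau>. \<sigma> \<in> ?K \<Longrightarrow> \<tau> \<subseteq> \<sigma> \<Longrightarrow> \<tau> \<in> ?K" by (rule face_complex_down)
    show "\<And>c. c \<in> X \<Longrightarrow> \<Gamma> c \<subseteq> ?K" using face_complex_nonempty by (simp add: \<Gamma>_def)
    show "\<Gamma> d \<subseteq> \<Gamma> c" if "c \<in> X" "d \<subseteq> c" for c d
    proof (cases "d = {}")
      case True
      then show ?thesis using face_complex_nonempty unfolding \<Gamma>_def by simp
    next
      case False
      then have ne: "c \<noteq> {}" using that(2) by blast
      have "\<sigma> \<inter> \<Inter>c = {}" if "\<sigma> \<inter> \<Inter>d = {}" for \<sigma>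
        using that Inter_anti_mono[OF \<open>d \<subseteq> c\<close>] by blast
      then show ?thesis using False ne by (simp add: \<Gamma>_def Collect_mono)
    qed
    show "{} \<in> \<Gamma> {}" by (simp add: \<Gamma>_def)
    show "\<And>\<sigma>. \<sigma> \<in> ?K \<Longrightarrow> \<Delta> \<sigma> \<subseteq> X" using \<Delta>D(1) by blast
    show "\<Delta> \<tau> \<subseteq> \<Delta> \<sigma>" if "\<tau> \<subseteq> \<sigma>" for \<sigma> \<tau>
    proof
      fix d assume d: "d \<in> \<Delta> \<tau>"
      have "\<exists>T. T \<noteq> {} \<and> T \<subseteq> \<sigma> \<and> F = ?cl T" if "F \<in> d" for F
      proof -
        obtain T where T: "T \<noteq> {}" "T \<subseteq> \<tau>" "F = ?cl T" using \<Delta>D(2)[OF d \<open>F \<in> d\<close>] by blast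
        then show ?thesis using subset_trans[OF T(2) \<open>\<tau> \<subseteq> \<sigma>\<close>] by (intro exI[of _ T]) simp
      qed
      then show "d \<in> \<Delta> \<sigma>" using \<Delta>D(1)[OF d] by (simp add: \<Delta>_def)
    qed
    show "{} \<in> \<Delta> {}" by (simp add: \<Delta>_def X_def)
  qed (fact finW finE \<Gamma>acyc \<Delta>acyc)+
  then obtain c \<sigma> where c: "c \<in> X" "c \<noteq> {}" "\<sigma> \<in> \<Gamma> c" "c \<in> \<Delta> \<sigma>" by blast
  have s: "\<sigma> \<in> ?K" "\<sigma> \<inter> \<Inter>c = {}" using c(2,3) by (simp_all add: \<Gamma>_def)
  obtain T where T: "T \<noteq> {}" "T \<subseteq> \<sigma>" "\<Inter>c = ?cl T"
    using \<Delta>D(2)[OF c(4) bottom[OF c(1,2)]] by blast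
  have "T \<subseteq> ?cl T" by (rule closure_increasing[OF subset_trans[OF T(2) KE[OF s(1)]]])
  then show False using T s(2) by blast
qed

end

theorem mainTheorem2:
  fixes E :: "'a set" and indep :: "'a set \<Rightarrow> bool"
    and \<C> :: "'a signed set" and r :: nat
  assumes "finite E"
    and "matroid E indep"
    and "matroid_rank indep E + 1 = r"
    and "oriented_matroid E \<C>"
    and "oriented_matroid_rank E \<C> = r"
    and "\<And>D. double_circuit E indep D \<Longrightarrow>
           \<exists>Y. positive_cocircuit E \<C> Y \<and> supp Y \<subseteq> D"
  shows "\<exists>C. positive_cocircuit E \<C> C \<and>
           matroid_rank indep (E - supp C) = matroid_rank indep E"
proof -
  have "circuit_rank E \<C> E = matroid_rank indep E + 1"
    using assms(3,5) by (simp add: oriented_matroid_rank_def)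
  then obtain \<sigma> where \<sigma>: "\<sigma> \<in> face_complex E \<C> {} {} E" "matroid_rank indep \<sigma> = matroid_rank indep E"
    using spanning_face_exists[OF assms(2,4) _ assms(6)] by blast
  from \<sigma>(1) obtain Y where Y: "\<sigma> \<subseteq> E" "Y \<in> covectors E \<C>" "supp Y \<inter> ({} \<union> \<sigma>) = {}"
    "snd Y \<inter> ({} \<union> E) = {}" "fst Y \<inter> ({} \<union> E) \<noteq> {}" by (rule face_complexE)
  have "snd Y = {}" "supp Y \<noteq> {}" using Y covector_signed[OF Y(2)] by (auto simp: supp_def)
  \<comment> \<open>Passing to a positive cocircuit inside \<open>supp Y\<close> keeps the spanning
    set \<open>\<sigma>\<close> in the complement.\<close>
  then obtain C where C: "positive_cocircuit E \<C> C" "supp C \<subseteq> supp Y"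
    using nonneg_covector_positive_cocircuit[OF assms(4) Y(2)] by blast
  have "matroid_rank indep \<sigma> \<le> matroid_rank indep (E - supp C)"
    by (rule matroid_rank_mono) (use assms(1) Y C matroid_empty[OF assms(2)] in auto)
  moreover have "matroid_rank indep (E - supp C) \<le> matroid_rank indep E"
    by (rule matroid_rank_mono) (use assms(1) matroid_empty[OF assms(2)] in auto)
  ultimately have "matroid_rank indep (E - supp C) = matroid_rank indep E" using \<sigma>(2) by simp
  then show ?thesis using C(1) by blast
qed

end
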